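(* Let $e\ge2$, $\ell\ge1$, $n\ge0$ be integers and let $\underline{s}=(s_0,\dots,s_{\ell-1})\in\mathbb{Z}^\ell$ be a multicharge. Let $\widetilde{\underline{s}}=(\widetilde{s}_0,\dots,\widetilde{s}_{\ell-1})$ be the unique multicharge in the orbit of $\underline{s}$ under $\widehat{S}_\ell$ such that $0\le\widetilde{s}_{\ell-1}\le\cdots\le\widetilde{s}_0\le e-1$, and let $w\in\widehat{S}_\ell$ be such that $w(\underline{s})=\widetilde{\underline{s}}$. Then $$B_e^{\underline{s}}(\Lambda_{\underline{\mathfrak{s}}}^{+})_n=\{\Gamma_{\widetilde{\underline{s}},\,w^{-1}(\widetilde{\underline{s}})}(\underline{\mu})\mid\underline{\mu}\in B_e^{\widetilde{\underline{s}}}(\Lambda_{\underline{\mathfrak{s}}}^{+})_n\}.$$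
   Context: A multipartition of length $\ell$ is an $\ell$-tuple of partitions; its rank $|\underline{\lambda}|$ is the sum of all parts; $\underline{\emptyset}$ is the empty one. A node is a triple $\gamma=(a,b,c)$: the box in row $a\ge1$ and column $b\ge1$ of component $c\in\{0,\dots,\ell-1\}$. It is removable if it belongs to $\underline{\lambda}$ and deleting it leaves a multipartition; addable if it is not in $\underline{\lambda}$ and adding it gives a multipartition. For a multicharge $\underline{s}\in\mathbb{Z}^\ell$ the content is $c(\gamma)=b-a+s_c$, and $\gamma$ is an $i$-node if $c(\gamma)\equiv i\pmod e$. Crystal $B_e^{\underline{s}}(\Lambda_{\underline{\mathfrak{s}}}^{+})$: order $i$-nodes by $\gamma_1\prec_{\underline{s}}^{+}\gamma_2$ iff $c(\gamma_1)<c(\gamma_2)$, or $c(\gamma_1)=c(\gamma_2)$ and $c_1<c_2$ (component indices). For $i\in\{0,\dots,e-1\}$ write the addable and removable $i$-nodes of $\underline{\lambda}$ in decreasing order for $\prec_{\underline{s}}^{+}$, encode addable nodes by $A$ and removable ones by $R$, and delete factors $RA$ repeatedly until a word $A^pR^q$ remains. If $p>0$, the node of the rightmost remaining $A$ is the good $i$-node, and there is an arrow $\underline{\lambda}\xrightarrow{i}\underline{\mu}$ iff $\underline{\mu}$ is $\underline{\lambda}$ with its good $i$-node added. $B_e^{\underline{s}}(\Lambda_{\underline{\mathfrak{s}}}^{+})$ is the connected component of $\underline{\emptyset}$ in the resulting graph on all multipartitions of length $\ell$; its vertices are called Uglov multipartitions, and $B_e^{\underline{s}}(\Lambda_{\underline{\mathfrak{s}}}^{+})_n$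 is the set of its vertices of rank $n$. It realizes the crystal of the irreducible $\mathcal{U}_v(\widehat{\mathfrak{sl}}_e)$-module of highest weight $\sum_k\Lambda_{s_k\bmod e}$. The extended affine symmetric group $\widehat{S}_\ell$ acts faithfully on $\mathbb{Z}^\ell$; it is generated by all permutations of the coordinates and all translations adding $e$ to one coordinate. If $\underline{s},\underline{s}'$ lie in the same orbit, the corresponding highest weights coincide and $\Gamma_{\underline{s},\underline{s}'}$ denotes the unique isomorphism of $\{0,\dots,e-1\}$-arrow-labelled graphs $B_e^{\underline{s}}(\Lambda_{\underline{\mathfrak{s}}}^{+})\to B_e^{\underline{s}'}(\Lambda_{\underline{\mathfrak{s}}}^{+})$; it sends $\underline{\emptyset}$ to $\underline{\emptyset}$. *)

theory Defs
  imports
    "HOL-Algebra.Algebra"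
    "HOL-Number_Theory.Cong"
    "HOL-Combinatorics.Permutations"
begin

subsection \<open>Multipartitions and nodes\<close>

(* A partition is the list of its positive parts; component c of a multipartition is lam ! c.
   A node (a, b, c) uses row and column numbers starting at 1 and component indices starting at 0. *)

type_synonym mpart = "nat list list"
type_synonym node = "nat \<times> nat \<times> nat"

definition partition :: "nat list \<Rightarrow> bool" where
  "partition xs \<longleftrightarrow> sorted_wrt (\<ge>) xs \<and> (\<forall>x\<in>set xs. 1 \<le> x)"

definition multipartitions :: "nat \<Rightarrow> mpart set" where
  "multipartitions l = {lam. length lam = l \<and> (\<forall>xs\<in>set lam. partition xs)}"

definition rank :: "mpart \<Rightarrow> nat" where
  "rank lam = sum_list (map sum_list lam)"

definition empty_mpart :: "nat \<Rightarrow> mpart" where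
  "empty_mpart l = replicate l []"

definition nodes :: "mpart \<Rightarrow> node set" where
  "nodes lam = {(a, b, c). c < length lam \<and> 1 \<le> a \<and> a \<le> length (lam ! c)
                          \<and> 1 \<le> b \<and> b \<le> lam ! c ! (a - 1)}"

definition removable :: "mpart \<Rightarrow> node \<Rightarrow> bool" where
  "removable lam g \<longleftrightarrow> g \<in> nodes lam
     \<and> (\<exists>mu\<in>multipartitions (length lam). nodes mu = nodes lam - {g})"

definition addable :: "mpart \<Rightarrow> node \<Rightarrow> bool" where
  "addable lam g \<longleftrightarrow> g \<notin> nodes lam
     \<and> (\<exists>mu\<in>multipartitions (length lam). nodes mu = insert g (nodes lam))"

subsection \<open>Multicharges, contents and the order on nodes\<close>

definition multicharges :: "nat \<Rightarrow> int list set" where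
  "multicharges l = {s. length s = l}"

fun content :: "int list \<Rightarrow> node \<Rightarrow> int" where
  "content s (a, b, c) = int b - int a + s ! c"

fun component :: "node \<Rightarrow> nat" where
  "component (a, b, c) = c"

definition i_node :: "nat \<Rightarrow> int list \<Rightarrow> nat \<Rightarrow> node \<Rightarrow> bool" where
  "i_node e s i g \<longleftrightarrow> [content s g = int i] (mod int e)"

definition node_less :: "int list \<Rightarrow> node \<Rightarrow> node \<Rightarrow> bool" where
  "node_less s g h \<longleftrightarrow> content s g < content s h
     \<or> (content s g = content s h \<and> component g < component h)"

subsection \<open>The crystal graph\<close>

datatype letter = Letter_A | Letter_R

(* The letters are kept together with the nodes they encode. *)
definition is_i_word :: "nat \<Rightarrow> int list \<Rightarrow> nat \<Rightarrow> mpart \<Rightarrow> (letter \<times> node) list \<Rightarrow> bool" where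
  "is_i_word e s i lam w \<longleftrightarrow>
     distinct w
     \<and> set w = {(Letter_A, g) | g. addable lam g \<and> i_node e s i g}
             \<union> {(Letter_R, g) | g. removable lam g \<and> i_node e s i g}
     \<and> sorted_wrt (\<lambda>x y. node_less s (snd y) (snd x)) w"

inductive cancel_RA :: "(letter \<times> node) list \<Rightarrow> (letter \<times> node) list \<Rightarrow> bool" where
  "cancel_RA (us @ [(Letter_R, g), (Letter_A, h)] @ vs) (us @ vs)"

definition good_node :: "nat \<Rightarrow> int list \<Rightarrow> nat \<Rightarrow> mpart \<Rightarrow> node \<Rightarrow> bool" where
  "good_node e s i lam g \<longleftrightarrow>
     (\<exists>w us vs. is_i_word e s i lam w
        \<and> cancel_RA\<^sup>*\<^sup>* w (us @ [(Letter_A, g)] @ vs)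
        \<and> (\<forall>x\<in>set us. fst x = Letter_A) \<and> (\<forall>x\<in>set vs. fst x = Letter_R))"

definition arrow :: "nat \<Rightarrow> int list \<Rightarrow> nat \<Rightarrow> mpart \<Rightarrow> mpart \<Rightarrow> bool" where
  "arrow e s i lam mu \<longleftrightarrow> i < e
     \<and> lam \<in> multipartitions (length s) \<and> mu \<in> multipartitions (length s)
     \<and> (\<exists>g. good_node e s i lam g \<and> nodes mu = insert g (nodes lam))"

definition adjacent :: "nat \<Rightarrow> int list \<Rightarrow> mpart \<Rightarrow> mpart \<Rightarrow> bool" where
  "adjacent e s lam mu \<longleftrightarrow> (\<exists>i. arrow e s i lam mu \<or> arrow e s i mu lam)"

(* The connected component ignores the direction of the arrows. *)
definition crystal :: "nat \<Rightarrow> int list \<Rightarrow> mpart set" where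
  "crystal e s = {mu. (adjacent e s)\<^sup>*\<^sup>* (empty_mpart (length s)) mu}"

definition crystal_rank :: "nat \<Rightarrow> int list \<Rightarrow> nat \<Rightarrow> mpart set" where
  "crystal_rank e s n = {mu \<in> crystal e s. rank mu = n}"

subsection \<open>Isomorphisms of crystals\<close>

definition crystal_iso :: "nat \<Rightarrow> int list \<Rightarrow> int list \<Rightarrow> (mpart \<Rightarrow> mpart) \<Rightarrow> bool" where
  "crystal_iso e s s' f \<longleftrightarrow>
     bij_betw f (crystal e s) (crystal e s')
     \<and> (\<forall>lam\<in>crystal e s. \<forall>mu\<in>crystal e s. \<forall>i<e.
          arrow e s i lam mu \<longleftrightarrow> arrow e s' i (f lam) (f mu))"

(* Extensionality fixes the values outside the crystal, so that uniqueness on the crystal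
   is uniqueness as a HOL function. *)
definition Gamma :: "nat \<Rightarrow> int list \<Rightarrow> int list \<Rightarrow> mpart \<Rightarrow> mpart" where
  "Gamma e s s' = (THE f. f \<in> extensional (crystal e s) \<and> crystal_iso e s s' f)"

subsection \<open>The extended affine symmetric group\<close>

definition coord_perm :: "nat \<Rightarrow> (nat \<Rightarrow> nat) \<Rightarrow> int list \<Rightarrow> int list" where
  "coord_perm l p = (\<lambda>s\<in>multicharges l. map (\<lambda>c. s ! p c) [0..<l])"

definition coord_shift :: "nat \<Rightarrow> nat \<Rightarrow> nat \<Rightarrow> int list \<Rightarrow> int list" where
  "coord_shift e l c = (\<lambda>s\<in>multicharges l. s[c := s ! c + int e])"

(* The action is faithful, so the group is taken to be its image in the permutations of Z^l. *)
definition ext_affine_sym :: "nat \<Rightarrow> nat \<Rightarrow> (int list \<Rightarrow> int list) monoid" where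
  "ext_affine_sym e l = subgroup_generated (BijGroup (multicharges l))
     ({coord_perm l p | p. p permutes {..<l}} \<union> {coord_shift e l c | c. c < l})"

definition in_fundamental_domain :: "nat \<Rightarrow> int list \<Rightarrow> bool" where
  "in_fundamental_domain e s \<longleftrightarrow>
     0 \<le> s ! (length s - 1) \<and> s ! 0 \<le> int e - 1
     \<and> (\<forall>c. Suc c < length s \<longrightarrow> s ! Suc c \<le> s ! c)"

end

theory Submission
  imports Defs
begin

text \<open>
  Multipartitions are encoded as configurations of beads, one \<open>\<int>\<close>-indexed abacus per component, so that
  adding a node of content \<open>j\<close> to component \<open>c\<close> is a hop of a bead from \<open>j\<close> to \<open>j + 1\<close>. Fix a residue
  \<open>i\<close> and list the pairs (content, component) of \<open>i\<close>-nodes in increasing order. The signature (\<open>1\<close> for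
  addable, \<open>-1\<close> for removable) is the difference sequence of a potential on the integers, and cancelling
  factors \<open>RA\<close> shows that the good node sits at the last place where this potential is maximal.

  For multicharges that differ by exchanging two neighbouring entries \<open>a \<ge> b\<close>, the isomorphism of
  crystals moves \<open>a - b\<close> beads between the two abaci, each bead staying at its content. Every single
  move is governed by the same rule in the transposed direction: compare the two abaci content by
  content and move the bead just below the first maximum of the resulting potential. A hop changes this
  potential at one point only, a move changes the potential of the hops at one point only, and in both
  cases the maximum is preserved and its place shifts by at most one; hence hops and moves commute.
  Rotating the components while subtracting \<open>e\<close> from the rotated charge changes neither the word nor the
  arrows. These two operations generate the orbits of the extended affine symmetric group. An
  isomorphism of crystals is unique and preserves ranks because arrows are deterministic in both
  directions and raise the rank by one.
\<close>

subsection \<open>Potentials on the integers\<close>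

text \<open>Formally \<open>potential s N\<close> is the sum of \<open>s\<close> over all integers
  from \<open>N\<close> on. That sum may diverge, so the value at \<open>0\<close> is normalised to
  \<open>0\<close> and only differences carry meaning.\<close>

definition potential :: "(int \<Rightarrow> int) \<Rightarrow> int \<Rightarrow> int" where
  "potential s N = (if N \<ge> 0 then - (\<Sum>M\<in>{0..<N}. s M) else (\<Sum>M\<in>{N..<0}. s M))"

definition is_potential :: "(int \<Rightarrow> int) \<Rightarrow> (int \<Rightarrow> int) \<Rightarrow> bool" where
  "is_potential s D \<longleftrightarrow> (\<forall>M. D M = D (M + 1) + s M)"

lemma is_potential_potential: "is_potential s (potential s)"
proof -
  have "potential s M = potential s (M + 1) + s M" for M
  proof (cases "M \<ge> 0")
    case True
    then have "{0..<M + 1} = insert M {0..<M}" by auto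
    then show ?thesis using True by (simp add: potential_def)
  next
    case False
    then have "{M..<0} = insert M {M + 1..<0}" by auto
    then have "(\<Sum>j\<in>{M..<0}. s j) = s M + (\<Sum>j\<in>{M + 1..<0}. s j)" by simp
    \<comment> \<open>For \<open>M = -1\<close> the next point is \<open>0\<close>, where the other
      branch of the definition applies.\<close>
    moreover have "M = -1 \<or> M + 1 < 0" using False by linarith
    ultimately show ?thesis using False unfolding potential_def by (elim disjE) simp_all
  qed
  then show ?thesis unfolding is_potential_def by blast
qed

definition last_argmax :: "(int \<Rightarrow> int) \<Rightarrow> int \<Rightarrow> bool" where
  "last_argmax D N \<longleftrightarrow> (\<forall>M. D M \<le> D N) \<and> (\<forall>M>N. D M < D N)"

definition first_argmax :: "(int \<Rightarrow> int) \<Rightarrow> int \<Rightarrow> bool" where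
  "first_argmax D N \<longleftrightarrow> (\<forall>M. D M \<le> D N) \<and> (\<forall>M<N. D M < D N)"

lemma last_argmax_unique: "last_argmax D M \<Longrightarrow> last_argmax D N \<Longrightarrow> M = N"
  unfolding last_argmax_def by (metis linorder_neqE not_less)

lemma first_argmax_unique: "first_argmax D M \<Longrightarrow> first_argmax D N \<Longrightarrow> M = N"
  unfolding first_argmax_def by (metis linorder_neqE not_less)

lemma is_potential_unique:
  assumes "is_potential s D" "is_potential s D'"
  shows "D M - D 0 = D' M - D' 0"
proof (induction M rule: int_induct[where k = 0])
  case (step1 i)
  then show ?case using assms unfolding is_potential_def by (smt (verit))
next
  case (step2 i)
  have "D (i - 1) = D i + s (i - 1)" "D' (i - 1) = D' i + s (i - 1)"
    using assms unfolding is_potential_def by (metis diff_add_cancel)+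
  then show ?case using step2 by linarith
qed simp

text \<open>Potentials of the same sequence differ by a constant. Hence an argmax may be computed
  with any convenient potential in place of the normalised one.\<close>

lemma last_argmax_is_potential:
  assumes "is_potential s D" "is_potential s D'"
  shows "last_argmax D N \<longleftrightarrow> last_argmax D' N"
proof -
  have "D M - D N = D' M - D' N" for M
    using is_potential_unique[OF assms, of M] is_potential_unique[OF assms, of N] by linarith
  then show ?thesis unfolding last_argmax_def by (smt (verit))
qed

lemma first_argmax_is_potential:
  assumes "is_potential s D" "is_potential s D'"
  shows "first_argmax D N \<longleftrightarrow> first_argmax D' N"
proof -
  have "D M - D N = D' M - D' N" for M
    using is_potential_unique[OF assms, of M] is_potential_unique[OF assms, of N] by linarith
  then show ?thesis unfolding first_argmax_def by (smt (verit))
qed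

section \<open>Raising a potential by one at a single point\<close>

definition valley :: "(int \<Rightarrow> int) \<Rightarrow> int \<Rightarrow> bool" where
  "valley D p \<longleftrightarrow> D p \<le> D (p - 1) \<and> D p \<le> D (p + 1) \<and> max (D (p - 1)) (D (p + 1)) = D p + 1"

text \<open>At a valley each neighbour has value \<open>D p\<close> or \<open>D p + 1\<close>, and
  at least one has \<open>D p + 1\<close>. Raising \<open>D p\<close> by one therefore never exceeds
  the larger neighbour, and a maximum of \<open>D\<close> keeps its value.\<close>

definition bump :: "(int \<Rightarrow> int) \<Rightarrow> int \<Rightarrow> (int \<Rightarrow> int) \<Rightarrow> bool" where
  "bump D p D' \<longleftrightarrow> D' = D(p := D p + 1) \<and> valley D p"

text \<open>The raised value only ties with the higher neighbour of \<open>p\<close>. If the last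
  argmax lies to the right of \<open>p\<close>, a tie does not affect it; if it lies to the left of
  \<open>p - 1\<close>, its value exceeds both neighbours and hence the raised value. Only
  \<open>p - 1\<close> can be displaced.\<close>

lemma bump_last:
  assumes "bump D p D'" "last_argmax D N"
  shows "last_argmax D' (if N = p - 1 then p else N)"
proof -
  have v: "D p \<le> D (p - 1)" "D p \<le> D (p + 1)" "D (p - 1) \<le> D p + 1" "D (p + 1) \<le> D p + 1"
    "D (p - 1) = D p + 1 \<or> D (p + 1) = D p + 1" and D': "D' = D(p := D p + 1)"
    using assms(1) unfolding bump_def valley_def by (auto split: if_splits simp: max_def)
  have a: "D M \<le> D N" "M > N \<Longrightarrow> D M < D N" for M
    using assms(2) unfolding last_argmax_def by auto
  consider "N = p - 1" | "N = p" | "N < p - 1" | "N > p" by linarith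
  then show ?thesis
  proof cases
    case 1
    have "D (p + 1) < D (p - 1)" using a(2)[of "p + 1"] 1 by simp
    then have "D (p - 1) = D p + 1" using v by linarith
    then have "D M \<le> D p + 1" "M > p \<Longrightarrow> D M < D p + 1" for M using a[of M] 1 by auto
    then show ?thesis using 1 by (auto simp: last_argmax_def D')
  next
    case 2
    then have "D (p + 1) < D p" using a(2)[of "p + 1"] by simp
    then show ?thesis using v by linarith
  next
    case 3
    have "D p + 1 < D N" using a(2)[of "p - 1"] a(2)[of "p + 1"] v 3 by auto
    then show ?thesis using 3 a by (auto simp: last_argmax_def D')
  next
    case 4
    have "D p + 1 \<le> D N" using a(1)[of "p - 1"] a(1)[of "p + 1"] v 4 by auto
    then show ?thesis using 4 a by (auto simp: last_argmax_def D')
  qed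
qed

text \<open>Here the existence of a last argmax passes from \<open>D'\<close> to \<open>D\<close>,
  which \<open>bump_last\<close> cannot give because it starts from an argmax of \<open>D\<close>.
  Together they make existence invariant under bumps.\<close>

lemma bump_last_back:
  assumes "bump D p D'" "last_argmax D' N"
  shows "last_argmax D (if N = p then p - 1 else N)"
proof -
  have v: "D p \<le> D (p - 1)" "D p \<le> D (p + 1)" "D (p - 1) \<le> D p + 1" "D (p + 1) \<le> D p + 1"
    "D (p - 1) = D p + 1 \<or> D (p + 1) = D p + 1" and D': "D' = D(p := D p + 1)"
    using assms(1) unfolding bump_def valley_def by (auto split: if_splits simp: max_def)
  have a: "D' M \<le> D' N" "M > N \<Longrightarrow> D' M < D' N" for M
    using assms(2) unfolding last_argmax_def by auto
  have b: "D M \<le> D' M" for M by (simp add: D')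
  show ?thesis
  proof (cases "N = p")
    case True
    \<comment> \<open>The right neighbour is thus not the high one, so \<open>p - 1\<close> is, and
      it takes over as last argmax.\<close>
    have "D (p + 1) < D p + 1" using a(2)[of "p + 1"] True by (simp add: D')
    then have *: "D (p - 1) = D p + 1" using v by linarith
    have "D M \<le> D p + 1" "M > p \<Longrightarrow> D M < D p + 1" for M
      using a(1)[of M] a(2)[of M] b[of M] True by (auto simp: D' split: if_splits)
    moreover have "M > p - 1 \<Longrightarrow> M = p \<or> M > p" for M by linarith
    moreover have "D p < D p + 1" by simp
    ultimately have "M > p - 1 \<Longrightarrow> D M < D p + 1" for M by blast
    then show ?thesis using True * \<open>\<And>M. D M \<le> D p + 1\<close> by (simp add: last_argmax_def)
  next
    case False
    then have "D' N = D N" by (simp add: D')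
    then have "D M \<le> D N" "M > N \<Longrightarrow> D M < D N" for M
      using a(1)[of M] a(2)[of M] b[of M] by auto
    then show ?thesis using False by (simp add: last_argmax_def)
  qed
qed

text \<open>Reflecting the integers exchanges first and last argmaxes and preserves valleys, so the
  results on first argmaxes come from those on last ones.\<close>

lemma argmax_reflect: "first_argmax D N \<longleftrightarrow> last_argmax (\<lambda>M. D (- M)) (- N)"
  unfolding first_argmax_def last_argmax_def
  by (metis add.inverse_inverse neg_less_iff_less)

lemma bump_reflect: "bump D p D' \<Longrightarrow> bump (\<lambda>M. D (- M)) (- p) (\<lambda>M. D' (- M))"
  unfolding bump_def valley_def by (auto simp: max_def fun_eq_iff add.commute split: if_splits)

lemma bump_first:
  assumes "bump D p D'" "first_argmax D N"
  shows "first_argmax D' (if N = p + 1 then p else N)"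
proof -
  have "last_argmax (\<lambda>M. D' (- M)) (if - N = - p - 1 then - p else - N)"
    using bump_last[OF bump_reflect[OF assms(1)]] assms(2)[unfolded argmax_reflect] by blast
  then show ?thesis unfolding argmax_reflect by (auto split: if_splits)
qed

lemma bump_first_back:
  assumes "bump D p D'" "first_argmax D' N"
  shows "first_argmax D (if N = p then p + 1 else N)"
proof -
  have "last_argmax (\<lambda>M. D (- M)) (if - N = - p then - p - 1 else - N)"
    using bump_last_back[OF bump_reflect[OF assms(1)]] assms(2)[unfolded argmax_reflect] by blast
  then show ?thesis unfolding argmax_reflect by (auto split: if_splits)
qed

text \<open>Reversing a hop or a move: its place can be recovered from the result.\<close>

lemma argmax_flip:
  assumes s: "\<And>M. M \<noteq> N \<Longrightarrow> s' M = s M" and N: "s N = 1" "s' N = -1"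
  shows "last_argmax (potential s) N \<longleftrightarrow> first_argmax (potential s') (N + 1)"
proof -
  define D where "D = potential s"
  have D: "D M = D (M + 1) + s M" for M
    using is_potential_potential[of s] unfolding is_potential_def D_def by blast
  \<comment> \<open>Changing the step at \<open>N\<close> from \<open>1\<close> to \<open>-1\<close>
    lowers the potential by \<open>2\<close> at all points up to \<open>N\<close>. The value at
    \<open>N + 1\<close>, one below the old maximum at \<open>N\<close>, thereby becomes the new
    maximum.\<close>
  define D' where "D' M = (if M \<le> N then D M - 2 else D M)" for M
  have D': "is_potential s' D'"
    unfolding is_potential_def
  proof
    fix M
    consider "M < N" | "M = N" | "M > N" by linarith
    then show "D' M = D' (M + 1) + s' M" using D[of M] s[of M] N by cases (auto simp: D'_def)
  qed
  have DN: "D N = D (N + 1) + 1" using D[of N] N by simp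
  have "last_argmax D N \<longleftrightarrow> first_argmax D' (N + 1)"
  proof
    assume "last_argmax D N"
    then have a: "D M \<le> D N" "M > N \<Longrightarrow> D M < D N" for M unfolding last_argmax_def by auto
    have "D' M \<le> D' (N + 1)" "M < N + 1 \<Longrightarrow> D' M < D' (N + 1)" for M
      using a(1)[of M] a(2)[of M] DN by (auto simp: D'_def)
    then show "first_argmax D' (N + 1)" by (simp add: first_argmax_def)
  next
    assume "first_argmax D' (N + 1)"
    then have a: "D' M \<le> D' (N + 1)" "M < N + 1 \<Longrightarrow> D' M < D' (N + 1)" for M
      unfolding first_argmax_def by auto
    have "D M \<le> D N" "M > N \<Longrightarrow> D M < D N" for M
      using a(1)[of M] a(2)[of M] DN by (auto simp: D'_def split: if_splits)
    then show "last_argmax D N" by (simp add: last_argmax_def)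
  qed
  then show ?thesis using first_argmax_is_potential[OF D' is_potential_potential] by (simp add: D_def)
qed

lemma last_argmax_pos: "last_argmax (potential s) N \<Longrightarrow> s N > 0"
  using is_potential_potential[of s] unfolding is_potential_def last_argmax_def
  by (smt (verit))

lemma first_argmax_neg: "first_argmax (potential s) (N + 1) \<Longrightarrow> s N < 0"
  using is_potential_potential[of s] unfolding is_potential_def first_argmax_def
  by (smt (verit))

text \<open>Opposite unit changes at \<open>p - 1\<close> and \<open>p\<close> cancel in every tail
  sum except the one starting at \<open>p\<close>. As \<open>D (p - 1) = D p + s (p - 1)\<close> and
  \<open>D (p + 1) = D p - s p\<close>, the conditions \<open>v\<close> say that \<open>p\<close> is
  a valley.\<close>

lemma bump_potential:
  assumes s: "\<And>M. M \<noteq> p \<Longrightarrow> M \<noteq> p - 1 \<Longrightarrow> s' M = s M"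
    and p: "s' p = s p + 1" "s' (p - 1) = s (p - 1) - 1"
    and v: "0 \<le> s (p - 1)" "s p \<le> 0" "s (p - 1) \<le> 1" "- 1 \<le> s p" "s (p - 1) \<noteq> 0 \<or> s p \<noteq> 0"
  obtains D' where "is_potential s' D'" "bump (potential s) p D'"
proof
  define D where "D = potential s"
  have D: "D M = D (M + 1) + s M" for M
    using is_potential_potential[of s] unfolding is_potential_def D_def by blast
  let ?D' = "(potential s)(p := potential s p + 1)"
  show "is_potential s' ?D'" unfolding is_potential_def
  proof
    fix M
    consider "M = p" | "M = p - 1" | "M \<noteq> p" "M \<noteq> p - 1" by blast
    then show "?D' M = ?D' (M + 1) + s' M"
      using D[of M] s[of M] p by cases (auto simp: D_def)
  qed
  show "bump (potential s) p ?D'"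
    using D[of p] D[of "p - 1"] v unfolding bump_def valley_def D_def[symmetric]
    by (auto simp: max_def)
qed

subsection \<open>Hops and moves of beads\<close>

type_synonym beads = "nat \<Rightarrow> int \<Rightarrow> bool"

definition hop :: "beads \<Rightarrow> nat \<Rightarrow> int \<Rightarrow> beads" where
  "hop B c j = B(c := (B c)(j := False, j + 1 := True))"

definition move_bead :: "nat \<Rightarrow> beads \<Rightarrow> int \<Rightarrow> beads" where
  "move_bead c B m = B(c := (B c)(m := False), Suc c := (B (Suc c))(m := True))"

text \<open>The integer \<open>k * l + c\<close> stands for the pair of content \<open>i + e * k\<close> and component \<open>c\<close>; the usual order
  of the integers is then \<open>node_less\<close> on the \<open>i\<close>-nodes.\<close>

definition pos_component :: "nat \<Rightarrow> int \<Rightarrow> nat" where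
  "pos_component l N = nat (N mod int l)"

definition pos_content :: "nat \<Rightarrow> nat \<Rightarrow> nat \<Rightarrow> int \<Rightarrow> int" where
  "pos_content e l i N = int i + int e * (N div int l)"

text \<open>Inverse to the pair of \<open>pos_component\<close> and \<open>pos_content\<close> for
  components below \<open>l\<close> and contents congruent to \<open>i\<close> modulo
  \<open>e\<close>; for other contents the division rounds.\<close>

definition position :: "nat \<Rightarrow> nat \<Rightarrow> nat \<Rightarrow> nat \<Rightarrow> int \<Rightarrow> int" where
  "position e l i c j = ((j - int i) div int e) * int l + int c"

text \<open>A bead at \<open>j\<close> with \<open>j + 1\<close> free stands for an addable node of
  content \<open>j\<close>, the opposite pattern for a removable node of content
  \<open>j\<close>.\<close>

definition signature :: "nat \<Rightarrow> nat \<Rightarrow> nat \<Rightarrow> beads \<Rightarrow> int \<Rightarrow> int" where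
  "signature e l i B N = of_bool (B (pos_component l N) (pos_content e l i N)) - of_bool (B (pos_component l N) (pos_content e l i N + 1))"

text \<open>The transpose of \<open>signature\<close>: the value \<open>-1\<close> marks a bead that
  can pass from \<open>c\<close> to \<open>Suc c\<close> at its content, the value \<open>1\<close>
  one that could pass back.\<close>

definition row_signature :: "nat \<Rightarrow> beads \<Rightarrow> int \<Rightarrow> int" where
  "row_signature c B m = of_bool (B (Suc c) m) - of_bool (B c m)"

text \<open>The Kashiwara operator of residue \<open>i\<close> on arbitrary configurations. It is
  partial: for instance, if no letter \<open>A\<close> survives cancellation, the maximum is
  attained arbitrarily far to the right and there is no last argmax.\<close>

definition f_step :: "nat \<Rightarrow> nat \<Rightarrow> nat \<Rightarrow> beads \<Rightarrow> beads \<Rightarrow> bool" where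
  "f_step e l i B B' \<longleftrightarrow> (\<exists>N. last_argmax (potential (signature e l i B)) N \<and> B' = hop B (pos_component l N) (pos_content e l i N))"

definition move_step :: "nat \<Rightarrow> beads \<Rightarrow> beads \<Rightarrow> bool" where
  "move_step c B B' \<longleftrightarrow> (\<exists>m. first_argmax (potential (row_signature c B)) (m + 1) \<and> B' = move_bead c B m)"

lemma pos_component_less: "l > 0 \<Longrightarrow> pos_component l N < l"
  unfolding pos_component_def by (metis nat_less_iff of_nat_0_less_iff pos_mod_bound pos_mod_sign)

lemma pos_component_position: "c < l \<Longrightarrow> pos_component l (position e l i c j) = c"
  unfolding pos_component_def position_def by simp

lemma pos_content_position: "c < l \<Longrightarrow> int e dvd j - int i \<Longrightarrow> pos_content e l i (position e l i c j) = j"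
  unfolding pos_content_def position_def by simp

lemma position_pos_component_pos_content: "l > 0 \<Longrightarrow> e > 0 \<Longrightarrow> position e l i (pos_component l N) (pos_content e l i N) = N"
  unfolding pos_component_def position_def pos_content_def by (simp add: mult.commute)

lemma dvd_pos_content: "int e dvd pos_content e l i N - int i"
  unfolding pos_content_def by simp

lemma position_Suc: "position e l i (Suc c) j = position e l i c j + 1"
  by (simp add: position_def)

lemma potential_step: "potential s M = potential s (M + 1) + s M"
  using is_potential_potential unfolding is_potential_def by blast

lemma signature_position: "c < l \<Longrightarrow> int e dvd j - int i \<Longrightarrow>
    signature e l i B (position e l i c j) = of_bool (B c j) - of_bool (B c (j + 1))"
  by (simp add: signature_def pos_component_position pos_content_position)

lemma hop_inj:
  assumes "hop B1 c j = hop B2 c j" "B1 c j" "\<not> B1 c (j + 1)" "B2 c j" "\<not> B2 c (j + 1)"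
  shows "B1 = B2"
proof (intro ext)
  fix c' j'
  have "hop B1 c j c' j' = hop B2 c j c' j'" using assms(1) by simp
  then show "B1 c' j' = B2 c' j'" using assms(2-) by (auto simp: hop_def split: if_splits)
qed

text \<open>Comparing the maximum at \<open>m + 1\<close> with the values at \<open>m\<close>,
  \<open>m + 2\<close> and \<open>m - 1\<close> yields the occupation patterns next to
  \<open>m\<close>. They are what turns the effect of the move on a signature into a bump.\<close>

lemma move_stepE:
  assumes "move_step c B B'"
  obtains m where "B c m" "\<not> B (Suc c) m" "B c (m + 1) \<Longrightarrow> B (Suc c) (m + 1)"
    "B (Suc c) (m - 1) \<Longrightarrow> B c (m - 1)"
    "first_argmax (potential (row_signature c B)) (m + 1)" "B' = move_bead c B m"
proof -
  obtain m where m: "first_argmax (potential (row_signature c B)) (m + 1)" "B' = move_bead c B m"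
    using assms unfolding move_step_def by blast
  have "row_signature c B m < 0" using first_argmax_neg[OF m(1)] .
  then have B: "B c m" "\<not> B (Suc c) m" by (auto simp: row_signature_def split: if_splits)
  have "potential (row_signature c B) (m + 2) \<le> potential (row_signature c B) (m + 1)" using m(1) unfolding first_argmax_def by blast
  then have "0 \<le> row_signature c B (m + 1)" using potential_step[of "row_signature c B" "m + 1"] by (simp add: add.assoc)
  then have B2: "B c (m + 1) \<Longrightarrow> B (Suc c) (m + 1)" by (auto simp: row_signature_def split: if_splits)
  have "potential (row_signature c B) (m - 1) < potential (row_signature c B) (m + 1)" using m(1) unfolding first_argmax_def by simp
  then have "row_signature c B (m - 1) + row_signature c B m < 0"
    using potential_step[of "row_signature c B" m] potential_step[of "row_signature c B" "m - 1"] by simp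
  then have "B (Suc c) (m - 1) \<Longrightarrow> B c (m - 1)" using B by (auto simp: row_signature_def split: if_splits)
  then show ?thesis using that m B B2 by blast
qed

lemma move_step_det: "move_step c B B1 \<Longrightarrow> move_step c B B2 \<Longrightarrow> B1 = B2"
  unfolding move_step_def using first_argmax_unique by fastforce

lemma move_bead_flip:
  assumes "B c m" "\<not> B (Suc c) m"
  shows "first_argmax (potential (row_signature c B)) (m + 1) \<longleftrightarrow> last_argmax (potential (row_signature c (move_bead c B m))) m"
  by (rule argmax_flip[symmetric]) (use assms in \<open>auto simp: row_signature_def move_bead_def\<close>)

lemma move_step_codet:
  assumes "move_step c B1 B" "move_step c B2 B"
  shows "B1 = B2"
proof -
  obtain m where 1: "B1 c m" "\<not> B1 (Suc c) m" "first_argmax (potential (row_signature c B1)) (m + 1)" "B = move_bead c B1 m"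
    using move_stepE[OF assms(1)] .
  obtain m' where 2: "B2 c m'" "\<not> B2 (Suc c) m'" "first_argmax (potential (row_signature c B2)) (m' + 1)" "B = move_bead c B2 m'"
    using move_stepE[OF assms(2)] .
  have "m = m'" using move_bead_flip 1 2 last_argmax_unique by metis
  then have *: "move_bead c B1 m = move_bead c B2 m" using 1 2 by simp
  show ?thesis
  proof (intro ext)
    fix c' j'
    have "move_bead c B1 m c' j' = move_bead c B2 m c' j'" using * by simp
    then show "B1 c' j' = B2 c' j'"
      using 1(1,2) 2(1,2) \<open>m = m'\<close> by (auto simp: move_bead_def split: if_splits)
  qed
qed

lemma move_step_defined_iff: "(\<exists>B'. move_step c B B') \<longleftrightarrow> (\<exists>N. first_argmax (potential (row_signature c B)) N)"
  unfolding move_step_def by (metis diff_add_cancel)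

lemma f_step_det: "f_step e l i B B1 \<Longrightarrow> f_step e l i B B2 \<Longrightarrow> B1 = B2"
  unfolding f_step_def using last_argmax_unique by blast

lemma f_step_defined_iff: "(\<exists>B'. f_step e l i B B') \<longleftrightarrow> (\<exists>N. last_argmax (potential (signature e l i B)) N)"
  unfolding f_step_def by blast

section \<open>Hops of a fixed residue and their interaction with moves\<close>

context
  fixes e l i :: nat
  assumes e: "2 \<le> e" and l: "0 < l"
begin

lemma signature_cong:
  assumes "\<And>j c'. c' < l \<Longrightarrow> int e dvd j - int i \<Longrightarrow> position e l i c' j = N \<Longrightarrow>
     B' c' j = B c' j \<and> B' c' (j + 1) = B c' (j + 1)"
  shows "signature e l i B' N = signature e l i B N"
  using assms[OF pos_component_less[OF l] dvd_pos_content position_pos_component_pos_content] l e by (simp add: signature_def)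

lemma f_stepE:
  assumes "f_step e l i B B'"
  obtains c j where "c < l" "int e dvd j - int i" "B c j" "\<not> B c (j + 1)"
    "last_argmax (potential (signature e l i B)) (position e l i c j)" "B' = hop B c j"
proof -
  obtain N where N: "last_argmax (potential (signature e l i B)) N" "B' = hop B (pos_component l N) (pos_content e l i N)"
    using assms unfolding f_step_def by blast
  have "signature e l i B N > 0" using last_argmax_pos[OF N(1)] .
  then have "B (pos_component l N) (pos_content e l i N)" "\<not> B (pos_component l N) (pos_content e l i N + 1)"
    by (auto simp: signature_def split: if_splits)
  then show ?thesis using that[OF pos_component_less[OF l] dvd_pos_content] N position_pos_component_pos_content[OF l] e by simp
qed

lemma f_stepI:
  assumes "c < l" "int e dvd j - int i" "last_argmax (potential (signature e l i B)) (position e l i c j)" "B' = hop B c j"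
  shows "f_step e l i B B'"
  using assms unfolding f_step_def by (metis pos_component_position pos_content_position)

text \<open>Because \<open>e \<ge> 2\<close>, adjacent contents never both have residue
  \<open>i\<close>. A hop from \<open>j\<close> to \<open>j + 1\<close> of residue \<open>i\<close>
  therefore alters a single entry of the signature, from \<open>1\<close> to
  \<open>-1\<close>.\<close>

lemma not_dvd_two: "int e dvd j - int i \<Longrightarrow> \<not> int e dvd j + 1 - int i"
proof
  assume "int e dvd j - int i" "int e dvd j + 1 - int i"
  then have "int e dvd (j + 1 - int i) - (j - int i)" by (rule dvd_diff[rotated])
  then show False using e by simp
qed

lemma hop_flip:
  assumes "c < l" "int e dvd j - int i" "B c j" "\<not> B c (j + 1)"
  shows "last_argmax (potential (signature e l i B)) (position e l i c j) \<longleftrightarrow>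
    first_argmax (potential (signature e l i (hop B c j))) (position e l i c j + 1)"
proof (rule argmax_flip)
  show "signature e l i B (position e l i c j) = 1" "signature e l i (hop B c j) (position e l i c j) = - 1"
    using assms by (simp_all add: signature_position hop_def)
  fix M assume M: "M \<noteq> position e l i c j"
  show "signature e l i (hop B c j) M = signature e l i B M"
  proof (rule signature_cong)
    fix j' c' assume a: "c' < l" "int e dvd j' - int i" "position e l i c' j' = M"
    then have "c' = c \<Longrightarrow> j' \<noteq> j" using M by blast
    moreover have "j' \<noteq> j + 1" "j' + 1 \<noteq> j"
      using not_dvd_two[OF assms(2)] not_dvd_two[OF a(2)] a(2) assms(2) by auto
    ultimately show "hop B c j c' j' = B c' j' \<and> hop B c j c' (j' + 1) = B c' (j' + 1)"
      by (auto simp: hop_def)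
  qed
qed

lemma f_step_codet:
  assumes "f_step e l i B1 B" "f_step e l i B2 B"
  shows "B1 = B2"
proof -
  obtain c1 j1 where 1: "c1 < l" "int e dvd j1 - int i" "B1 c1 j1" "\<not> B1 c1 (j1 + 1)"
    "last_argmax (potential (signature e l i B1)) (position e l i c1 j1)" "B = hop B1 c1 j1"
    using f_stepE[OF assms(1)] .
  obtain c2 j2 where 2: "c2 < l" "int e dvd j2 - int i" "B2 c2 j2" "\<not> B2 c2 (j2 + 1)"
    "last_argmax (potential (signature e l i B2)) (position e l i c2 j2)" "B = hop B2 c2 j2"
    using f_stepE[OF assms(2)] .
  have "first_argmax (potential (signature e l i B)) (position e l i c1 j1 + 1)" using hop_flip 1 by blast
  moreover have "first_argmax (potential (signature e l i B)) (position e l i c2 j2 + 1)" using hop_flip 2 by blast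
  ultimately have *: "position e l i c1 j1 = position e l i c2 j2" using first_argmax_unique by fastforce
  have "c1 = c2" using 1(1) 2(1) * pos_component_position by metis
  moreover have "j1 = j2" using 1(1,2) 2(1,2) * pos_content_position by metis
  ultimately show ?thesis using hop_inj 1 2 by blast
qed

text \<open>A first maximum at \<open>N + 1\<close> forces a negative entry at \<open>N\<close>,
  that is, a bead that can hop back; \<open>hop_flip\<close> then shows that the reversed hop is the
  one prescribed by the argmax.\<close>

lemma f_step_into_iff: "(\<exists>B'. f_step e l i B' B) \<longleftrightarrow> (\<exists>N. first_argmax (potential (signature e l i B)) N)"
proof
  assume "\<exists>B'. f_step e l i B' B"
  then show "\<exists>N. first_argmax (potential (signature e l i B)) N" using f_stepE hop_flip by metis
next
  assume "\<exists>N. first_argmax (potential (signature e l i B)) N"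
  then obtain N where N: "first_argmax (potential (signature e l i B)) (N + 1)" by (metis diff_add_cancel)
  define c j where "c = pos_component l N" and "j = pos_content e l i N"
  have cj: "c < l" "int e dvd j - int i" "position e l i c j = N"
    using pos_component_less[OF l] dvd_pos_content position_pos_component_pos_content[OF l] e unfolding c_def j_def by auto
  have "signature e l i B N < 0" using first_argmax_neg[OF N] .
  then have B: "\<not> B c j" "B c (j + 1)" by (auto simp: signature_def c_def j_def split: if_splits)
  define B' where "B' = B(c := (B c)(j := True, j + 1 := False))"
  have "B = hop B' c j" unfolding hop_def B'_def using B by (auto simp: fun_eq_iff)
  moreover have "B' c j" "\<not> B' c (j + 1)" by (auto simp: B'_def)
  ultimately have "f_step e l i B' B" using hop_flip[OF cj(1,2), of B'] N cj(3) f_stepI[OF cj(1,2)] by auto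
  then show "\<exists>B'. f_step e l i B' B" by blast
qed

text \<open>Nodes of equal content in the components \<open>c\<close> and \<open>Suc c\<close>
  occupy consecutive positions. The move changes the two entries of content \<open>m\<close>, or
  those of content \<open>m - 1\<close>, by opposite units: a bump from old to new potential for
  \<open>m\<close>, from new to old for \<open>m - 1\<close>. At most one of these contents has
  residue \<open>i\<close>.\<close>

lemma move_step_bump:
  assumes c: "Suc c < l" and B: "B c m" "\<not> B (Suc c) m" "B c (m + 1) \<Longrightarrow> B (Suc c) (m + 1)"
    "B (Suc c) (m - 1) \<Longrightarrow> B c (m - 1)"
  shows "int e dvd m - int i \<Longrightarrow> \<exists>D'. is_potential (signature e l i (move_bead c B m)) D' \<and>
            bump (potential (signature e l i B)) (position e l i (Suc c) m) D'" (is "_ \<Longrightarrow> ?A")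
    and "int e dvd m - 1 - int i \<Longrightarrow> \<exists>D'. is_potential (signature e l i B) D' \<and>
            bump (potential (signature e l i (move_bead c B m))) (position e l i (Suc c) (m - 1)) D'" (is "_ \<Longrightarrow> ?C")
    and "\<not> int e dvd m - int i \<Longrightarrow> \<not> int e dvd m - 1 - int i \<Longrightarrow> signature e l i (move_bead c B m) = signature e l i B"
proof -
  have c': "c < l" using c by simp
  { assume d: "int e dvd m - int i"
    have n: "\<not> int e dvd m - 1 - int i" using not_dvd_two[of "m - 1"] d by auto
    let ?p = "position e l i (Suc c) m"
    have "signature e l i (move_bead c B m) M = signature e l i B M" if "M \<noteq> ?p" "M \<noteq> ?p - 1" for M
    proof (rule signature_cong)
      fix j' d' assume a: "d' < l" "int e dvd j' - int i" "position e l i d' j' = M"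
      then have "j' = m \<Longrightarrow> d' \<noteq> c \<and> d' \<noteq> Suc c" using that position_Suc by auto
      moreover have "j' + 1 \<noteq> m" using n a(2) by auto
      ultimately show "move_bead c B m d' j' = B d' j' \<and> move_bead c B m d' (j' + 1) = B d' (j' + 1)"
        by (auto simp: move_bead_def)
    qed
    then show ?A
      using signature_position[OF c d, of B] signature_position[OF c' d, of B] signature_position[OF c d, of "move_bead c B m"]
        signature_position[OF c' d, of "move_bead c B m"] B
      by - (rule bump_potential[of ?p "signature e l i (move_bead c B m)" "signature e l i B"], auto simp: position_Suc move_bead_def) }
  { assume d: "int e dvd m - 1 - int i"
    have n: "\<not> int e dvd m - int i" using not_dvd_two[OF d] by simp
    let ?p = "position e l i (Suc c) (m - 1)"
    have "signature e l i B M = signature e l i (move_bead c B m) M" if "M \<noteq> ?p" "M \<noteq> ?p - 1" for M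
    proof (rule signature_cong)
      fix j' d' assume a: "d' < l" "int e dvd j' - int i" "position e l i d' j' = M"
      then have "j' = m - 1 \<Longrightarrow> d' \<noteq> c \<and> d' \<noteq> Suc c" using that position_Suc by auto
      moreover have "j' \<noteq> m" using n a(2) by auto
      ultimately show "B d' j' = move_bead c B m d' j' \<and> B d' (j' + 1) = move_bead c B m d' (j' + 1)"
        by (auto simp: move_bead_def)
    qed
    then show ?C
      using signature_position[OF c d, of B] signature_position[OF c' d, of B] signature_position[OF c d, of "move_bead c B m"]
        signature_position[OF c' d, of "move_bead c B m"] B
      by - (rule bump_potential[of ?p "signature e l i B" "signature e l i (move_bead c B m)"], auto simp: position_Suc move_bead_def) }
  { assume d: "\<not> int e dvd m - int i" "\<not> int e dvd m - 1 - int i"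
    have "signature e l i (move_bead c B m) M = signature e l i B M" for M
    proof (rule signature_cong)
      fix j' d' assume a: "d' < l" "int e dvd j' - int i" "position e l i d' j' = M"
      then have "j' \<noteq> m" "j' + 1 \<noteq> m" using d by auto
      then show "move_bead c B m d' j' = B d' j' \<and> move_bead c B m d' (j' + 1) = B d' (j' + 1)"
        by (auto simp: move_bead_def)
    qed
    then show "signature e l i (move_bead c B m) = signature e l i B" by blast }
qed

text \<open>Moves preserve whether a hop out of, or into, a configuration exists: the two signatures
  have potentials that are equal or related by one bump in some direction.\<close>

lemma move_step_last_argmax:
  assumes c: "Suc c < l" and B: "move_step c B B'"
  shows "(\<exists>N. last_argmax (potential (signature e l i B)) N) \<longleftrightarrow> (\<exists>N. last_argmax (potential (signature e l i B')) N)"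
    and "(\<exists>N. first_argmax (potential (signature e l i B)) N) \<longleftrightarrow> (\<exists>N. first_argmax (potential (signature e l i B')) N)"
proof -
  obtain m where m: "B c m" "\<not> B (Suc c) m" "B c (m + 1) \<Longrightarrow> B (Suc c) (m + 1)"
    "B (Suc c) (m - 1) \<Longrightarrow> B c (m - 1)" "B' = move_bead c B m"
    using move_stepE[OF B] by metis
  note mb = move_step_bump[OF c m(1-4)]
  have "\<exists>D D' p. is_potential (signature e l i B) D \<and> is_potential (signature e l i B') D' \<and> (bump D p D' \<or> bump D' p D \<or> D = D')"
    using mb m(5) is_potential_potential by metis
  then obtain D D' p where D: "is_potential (signature e l i B) D" "is_potential (signature e l i B') D'"
    and b: "bump D p D' \<or> bump D' p D \<or> D = D'" by blast
  note iff = last_argmax_is_potential[OF is_potential_potential D(1)] last_argmax_is_potential[OF is_potential_potential D(2)]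
    first_argmax_is_potential[OF is_potential_potential D(1)] first_argmax_is_potential[OF is_potential_potential D(2)]
  show "(\<exists>N. last_argmax (potential (signature e l i B)) N) \<longleftrightarrow> (\<exists>N. last_argmax (potential (signature e l i B')) N)"
    unfolding iff using b bump_last bump_last_back by meson
  show "(\<exists>N. first_argmax (potential (signature e l i B)) N) \<longleftrightarrow> (\<exists>N. first_argmax (potential (signature e l i B')) N)"
    unfolding iff using b bump_first bump_first_back by meson
qed

text \<open>Mirror image of \<open>move_step_bump\<close>: a hop in \<open>c\<close> or
  \<open>Suc c\<close> shifts one unit of \<open>row_signature\<close> between \<open>j\<close> and
  \<open>j + 1\<close>. The argmax hypothesis, read off at the adjacent position, supplies the
  valley.\<close>

lemma hop_bump:
  assumes c: "Suc c < l" and d: "int e dvd j - int i" and B: "B d' j" "\<not> B d' (j + 1)" "d' < l"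
    and N: "last_argmax (potential (signature e l i B)) (position e l i d' j)"
  shows "d' = c \<Longrightarrow> \<exists>D'. is_potential (row_signature c B) D' \<and> bump (potential (row_signature c (hop B d' j))) (j + 1) D'"
    and "d' = Suc c \<Longrightarrow> \<exists>D'. is_potential (row_signature c (hop B d' j)) D' \<and> bump (potential (row_signature c B)) (j + 1) D'"
    and "d' \<noteq> c \<Longrightarrow> d' \<noteq> Suc c \<Longrightarrow> row_signature c (hop B d' j) = row_signature c B"
proof -
  have c': "c < l" using c by simp
  let ?N = "position e l i d' j" and ?D = "potential (signature e l i B)"
  { assume h: "d' = c"
    \<comment> \<open>Position \<open>?N + 1\<close> has content \<open>j\<close> and component
      \<open>Suc c\<close>. An entry \<open>-1\<close> there would make the value at
      \<open>?N + 2\<close> equal to the maximum.\<close>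
    have "?D (?N + 1 + 1) < ?D ?N" using N unfolding last_argmax_def by simp
    then have "0 < signature e l i B (position e l i c j) + signature e l i B (position e l i (Suc c) j)"
      using potential_step[of "signature e l i B" ?N] potential_step[of "signature e l i B" "?N + 1"] h by (simp add: position_Suc)
    then have "B (Suc c) (j + 1) \<Longrightarrow> B (Suc c) j"
      using B h unfolding signature_position[OF c d] signature_position[OF c' d] by (auto split: if_splits)
    then show "\<exists>D'. is_potential (row_signature c B) D' \<and> bump (potential (row_signature c (hop B d' j))) (j + 1) D'"
      using B h by - (rule bump_potential[of "j + 1" "row_signature c B" "row_signature c (hop B d' j)"],
        auto simp: row_signature_def hop_def) }
  { assume h: "d' = Suc c"
    \<comment> \<open>Position \<open>?N - 1\<close> has content \<open>j\<close> and component
      \<open>c\<close>. An entry \<open>1\<close> there would exceed the maximum.\<close>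
    have "?D (?N - 1) \<le> ?D ?N" using N unfolding last_argmax_def by simp
    then have "signature e l i B (position e l i c j) \<le> 0"
      using potential_step[of "signature e l i B" "?N - 1"] h by (simp add: position_Suc)
    then have "B c j \<Longrightarrow> B c (j + 1)"
      using B h unfolding signature_position[OF c' d] by (cases "B c (j + 1)") auto
    then show "\<exists>D'. is_potential (row_signature c (hop B d' j)) D' \<and> bump (potential (row_signature c B)) (j + 1) D'"
      using B h by - (rule bump_potential[of "j + 1" "row_signature c (hop B d' j)" "row_signature c B"],
        auto simp: row_signature_def hop_def) }
  show "d' \<noteq> c \<Longrightarrow> d' \<noteq> Suc c \<Longrightarrow> row_signature c (hop B d' j) = row_signature c B"
    by (auto simp: row_signature_def hop_def)
qed

lemma f_step_first_argmax:
  assumes c: "Suc c < l" and B: "f_step e l i B B'"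
  shows "(\<exists>N. first_argmax (potential (row_signature c B)) N) \<longleftrightarrow> (\<exists>N. first_argmax (potential (row_signature c B')) N)"
proof -
  obtain d' j where h: "d' < l" "int e dvd j - int i" "B d' j" "\<not> B d' (j + 1)"
    "last_argmax (potential (signature e l i B)) (position e l i d' j)" "B' = hop B d' j"
    using f_stepE[OF B] .
  note mb = hop_bump[OF c h(2,3,4,1,5)]
  have "\<exists>D D' p. is_potential (row_signature c B) D \<and> is_potential (row_signature c B') D' \<and> (bump D p D' \<or> bump D' p D \<or> D = D')"
    using mb h(6) is_potential_potential by metis
  then obtain D D' p where D: "is_potential (row_signature c B) D" "is_potential (row_signature c B') D'"
    and b: "bump D p D' \<or> bump D' p D \<or> D = D'" by blast
  note iff = first_argmax_is_potential[OF is_potential_potential D(1)] first_argmax_is_potential[OF is_potential_potential D(2)]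
  show ?thesis unfolding iff using b bump_first bump_first_back by meson
qed

text \<open>Each operation changes the potential of the other by at most one bump, so the argmax
  lemmas locate the second operation after the first. It then remains to compare the two final
  configurations.\<close>

lemma move_step_f_step_commute:
  assumes c: "Suc c < l" and 1: "move_step c B B1" and 2: "f_step e l i B B2"
  shows "\<exists>B3. f_step e l i B1 B3 \<and> move_step c B2 B3"
proof -
  obtain m where m: "B c m" "\<not> B (Suc c) m" "B c (m + 1) \<Longrightarrow> B (Suc c) (m + 1)"
    "B (Suc c) (m - 1) \<Longrightarrow> B c (m - 1)" "first_argmax (potential (row_signature c B)) (m + 1)" "B1 = move_bead c B m"
    using move_stepE[OF 1] by metis
  obtain d j where h: "d < l" "int e dvd j - int i" "B d j" "\<not> B d (j + 1)"
    "last_argmax (potential (signature e l i B)) (position e l i d j)" "B2 = hop B d j"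
    using f_stepE[OF 2] .
  let ?N = "position e l i d j"
  note mb = move_step_bump[OF c m(1-4)] and hb = hop_bump[OF c h(2,3,4,1,5)]
  have c': "c < l" using c by simp
  have inj: "?N = position e l i d' j' \<longleftrightarrow> d = d' \<and> j = j'" if "d' < l" "int e dvd j' - int i" for d' j'
    using pos_component_position pos_content_position that h(1,2) by metis
  \<comment> \<open>\<open>d1\<close> is the component of the hop after the move, \<open>m2\<close>
    the content of the move after the hop. They differ from \<open>d\<close> and \<open>m\<close> in
    two cases only: both operations take the same bead, or both would fill the place
    \<open>j + 1\<close> of \<open>Suc c\<close>.\<close>
  define d1 where "d1 = (if d = c \<and> m = j then Suc c else if d = Suc c \<and> m = j + 1 then c else d)"
  define m2 where "m2 = (if d = c \<and> m = j then j + 1 else if d = Suc c \<and> m = j + 1 then j else m)"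
  have d1: "d1 < l" using c h(1) by (auto simp: d1_def)
  have "last_argmax (potential (signature e l i B1)) (position e l i d1 j)"
  proof -
    consider (A) "int e dvd m - int i" | (C) "int e dvd m - 1 - int i"
      | (O) "\<not> int e dvd m - int i" "\<not> int e dvd m - 1 - int i" by blast
    then show ?thesis
    proof cases
      case A
      then obtain D' where D': "is_potential (signature e l i B1) D'"
        "bump (potential (signature e l i B)) (position e l i (Suc c) m) D'" using mb(1) m(6) by blast
      have "?N = position e l i (Suc c) m - 1 \<longleftrightarrow> d = c \<and> j = m"
        using inj[OF c' A] by (simp add: position_Suc)
      moreover have "m \<noteq> j + 1" using not_dvd_two[OF h(2)] A by auto
      ultimately have "last_argmax D' (position e l i d1 j)"
        using bump_last[OF D'(2) h(5)] by (auto simp: d1_def split: if_splits)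
      then show ?thesis using last_argmax_is_potential[OF is_potential_potential D'(1)] by blast
    next
      case C
      then obtain D' where D': "is_potential (signature e l i B) D'"
        "bump (potential (signature e l i B1)) (position e l i (Suc c) (m - 1)) D'" using mb(2) m(6) by blast
      have *: "?N = position e l i (Suc c) (m - 1) \<longleftrightarrow> d = Suc c \<and> j = m - 1"
        using inj[OF c C] by simp
      have "m \<noteq> j" using not_dvd_two[OF C] h(2) by auto
      moreover have "last_argmax D' ?N" using last_argmax_is_potential[OF is_potential_potential D'(1)] h(5) by blast
      note bump_last_back[OF D'(2) this]
      ultimately show ?thesis
        using * by (auto simp: d1_def position_Suc split: if_splits)
    next
      case O
      then have "m \<noteq> j" "m \<noteq> j + 1" using h(2) by auto
      then show ?thesis using mb(3) O m(6) h(5) by (auto simp: d1_def)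
    qed
  qed
  then have f: "f_step e l i B1 (hop B1 d1 j)" using f_stepI[OF d1 h(2)] by blast
  have "first_argmax (potential (row_signature c B2)) (m2 + 1)"
  proof -
    consider (A) "d = c" | (C) "d = Suc c" | (O) "d \<noteq> c" "d \<noteq> Suc c" by blast
    then show ?thesis
    proof cases
      case A
      then obtain D' where D': "is_potential (row_signature c B) D'" "bump (potential (row_signature c B2)) (j + 1) D'"
        using hb(1) h(6) by blast
      have "first_argmax D' (m + 1)" using first_argmax_is_potential[OF is_potential_potential D'(1)] m(5) by blast
      from bump_first_back[OF D'(2) this] show ?thesis
        using A by (auto simp: m2_def split: if_splits)
    next
      case C
      then obtain D' where D': "is_potential (row_signature c B2) D'" "bump (potential (row_signature c B)) (j + 1) D'"
        using hb(2) h(6) by blast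
      have "first_argmax D' (m2 + 1)"
        using bump_first[OF D'(2) m(5)] C by (auto simp: m2_def split: if_splits)
      then show ?thesis using first_argmax_is_potential[OF is_potential_potential D'(1)] by blast
    next
      case O
      then show ?thesis using hb(3) h(6) m(5) by (auto simp: m2_def)
    qed
  qed
  then have g: "move_step c B2 (move_bead c B2 m2)" unfolding move_step_def by blast
  have "hop B1 d1 j = move_bead c B2 m2"
  proof (intro ext)
    fix c' j'
    consider (X) "d = c" "m = j" | (Y) "d = Suc c" "m = j + 1"
      | (Z) "\<not> (d = c \<and> m = j)" "\<not> (d = Suc c \<and> m = j + 1)" by blast
    then show "hop B1 d1 j c' j' = move_bead c B2 m2 c' j'"
    proof cases
      case X
      then show ?thesis using h(3,4,6) m(1-4,6)
        by (auto simp: d1_def m2_def hop_def move_bead_def)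
    next
      case Y
      \<comment> \<open>This bead is the one that hops after the move, and also the one that moves
        after the hop.\<close>
      then have "B c j" using m(4) h(3) by simp
      with Y show ?thesis using h(3,4,6) m(1,2,6)
        by (auto simp: d1_def m2_def hop_def move_bead_def)
    next
      case Z
      have "d = c \<Longrightarrow> m \<noteq> j + 1" using m(1) h(4) by auto
      moreover have "d = Suc c \<Longrightarrow> m \<noteq> j" using m(2) h(3) by auto
      ultimately show ?thesis using Z h(6) m(6)
        by (auto simp: d1_def m2_def hop_def move_bead_def)
    qed
  qed
  then show ?thesis using f g by auto
qed

text \<open>The commuting square treats a hop and a move with common source. For the other
  directions the missing edge exists because moves and hops preserve the existence of argmaxes, and
  determinism forwards or backwards identifies its other end.\<close>

lemma move_step_f_step_simulation:
  assumes c: "Suc c < l" and 1: "move_step c B B1"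
  shows "f_step e l i B B2 \<Longrightarrow> \<exists>B3. f_step e l i B1 B3 \<and> move_step c B2 B3"
    and "f_step e l i B1 B3 \<Longrightarrow> \<exists>B2. f_step e l i B B2 \<and> move_step c B2 B3"
    and "f_step e l i B2 B \<Longrightarrow> \<exists>B3. f_step e l i B3 B1 \<and> move_step c B2 B3"
    and "f_step e l i B3 B1 \<Longrightarrow> \<exists>B2. f_step e l i B2 B \<and> move_step c B2 B3"
proof -
  show "f_step e l i B B2 \<Longrightarrow> \<exists>B3. f_step e l i B1 B3 \<and> move_step c B2 B3"
    using move_step_f_step_commute[OF c 1] .
  { assume f: "f_step e l i B1 B3"
    then obtain B2 where "f_step e l i B B2"
      using move_step_last_argmax(1)[OF c 1] f_step_defined_iff by metis
    then show "\<exists>B2. f_step e l i B B2 \<and> move_step c B2 B3"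
      using move_step_f_step_commute[OF c 1] f_step_det[OF f] by blast }
  have *: "\<exists>B3. f_step e l i B3 B1 \<and> move_step c B2 B3" if f: "f_step e l i B2 B" for B2
  proof -
    obtain B3 where B3: "move_step c B2 B3"
      using f_step_first_argmax[OF c f] 1 move_step_defined_iff by metis
    then show ?thesis using move_step_f_step_commute[OF c B3 f] move_step_det[OF 1] by blast
  qed
  then show "f_step e l i B2 B \<Longrightarrow> \<exists>B3. f_step e l i B3 B1 \<and> move_step c B2 B3" .
  { assume f: "f_step e l i B3 B1"
    then obtain B2 where "f_step e l i B2 B"
      using move_step_last_argmax(2)[OF c 1] f_step_into_iff by metis
    then show "\<exists>B2. f_step e l i B2 B \<and> move_step c B2 B3"
      using * f_step_codet[OF f] by blast }
qed

end

subsection \<open>Cancellation of words\<close>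

fun letter_value :: "letter \<Rightarrow> int" where
  "letter_value Letter_A = 1" | "letter_value Letter_R = - 1"

definition height :: "(letter \<times> 'a) list \<Rightarrow> int" where
  "height w = (\<Sum>x\<leftarrow>w. letter_value (fst x))"

lemma height_simps [simp]: "height [] = 0" "height (x # w) = letter_value (fst x) + height w" "height (u @ v) = height u + height v"
  by (simp_all add: height_def)

text \<open>Words in which every \<open>R\<close> can be matched with an \<open>A\<close> further
  right; this is the invariant for what stands left of the good letter.\<close>

fun suffixes_nonneg :: "(letter \<times> 'a) list \<Rightarrow> bool" where
  "suffixes_nonneg [] \<longleftrightarrow> True"
| "suffixes_nonneg (x # w) \<longleftrightarrow> 0 \<le> height (x # w) \<and> suffixes_nonneg w"

text \<open>For \<open>h = 0\<close> these are the words in which every \<open>A\<close> can be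
  matched with an \<open>R\<close> further left, the invariant to the right of the good letter. The
  parameter carries the height already read.\<close>

fun prefixes_nonpos :: "int \<Rightarrow> (letter \<times> 'a) list \<Rightarrow> bool" where
  "prefixes_nonpos h [] \<longleftrightarrow> h \<le> 0"
| "prefixes_nonpos h (x # w) \<longleftrightarrow> h \<le> 0 \<and> prefixes_nonpos (h + letter_value (fst x)) w"

lemma suffixes_nonneg_height: "suffixes_nonneg (u @ v) \<Longrightarrow> 0 \<le> height v"
  by (induction u) (cases v; auto)+

lemma prefixes_nonpos_height: "prefixes_nonpos h (u @ v) \<Longrightarrow> h + height u \<le> 0"
  by (induction u arbitrary: h) (cases v; force simp: add.assoc)+

lemma suffixes_nonneg_insert: "suffixes_nonneg (u @ v) \<Longrightarrow> suffixes_nonneg (u @ (Letter_R, g) # (Letter_A, h) # v)"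
  by (induction u) (use suffixes_nonneg_height[of "[]" v] in auto)

lemma prefixes_nonpos_insert: "prefixes_nonpos k (u @ v) \<Longrightarrow> prefixes_nonpos k (u @ (Letter_R, g) # (Letter_A, h) # v)"
proof (induction u arbitrary: k)
  case Nil
  then have "k \<le> 0" by (cases v) auto
  then show ?case using Nil by auto
qed auto

lemma suffixes_nonneg_A: "\<forall>x\<in>set u. fst x = Letter_A \<Longrightarrow> suffixes_nonneg u \<and> 0 \<le> height u"
  by (induction u) auto

lemma prefixes_nonpos_R: "\<forall>x\<in>set v. fst x = Letter_R \<Longrightarrow> k \<le> 0 \<Longrightarrow> prefixes_nonpos k v"
  by (induction v arbitrary: k) auto

text \<open>A cancelled factor \<open>RA\<close> is reinserted entirely to the left or entirely to
  the right of the marked letter. It has height \<open>0\<close>, and a cut through its middle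
  leaves \<open>A\<close> to the suffix and \<open>R\<close> to the prefix, so both invariants
  survive.\<close>

lemma cancel_RA_split:
  assumes "cancel_RA w (us @ x # vs)" "suffixes_nonneg us" "prefixes_nonpos 0 vs"
  shows "\<exists>us' vs'. w = us' @ x # vs' \<and> suffixes_nonneg us' \<and> prefixes_nonpos 0 vs'"
proof -
  obtain p q g h where w: "w = p @ [(Letter_R, g), (Letter_A, h)] @ q" "us @ x # vs = p @ q"
    using assms(1) by (auto elim: cancel_RA.cases)
  then consider r where "us = p @ r" "q = r @ x # vs" | r where "p = us @ x # r" "vs = r @ q"
    by (auto simp: append_eq_append_conv2 Cons_eq_append_conv)
  then show ?thesis
  proof cases
    case 1
    then have "w = (p @ (Letter_R, g) # (Letter_A, h) # r) @ x # vs" using w by simp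
    moreover have "suffixes_nonneg (p @ (Letter_R, g) # (Letter_A, h) # r)"
      using suffixes_nonneg_insert[of p r] assms(2) 1(1) by blast
    ultimately show ?thesis using assms(3) by blast
  next
    case 2
    then have "w = us @ x # (r @ (Letter_R, g) # (Letter_A, h) # q)" using w by simp
    moreover have "prefixes_nonpos 0 (r @ (Letter_R, g) # (Letter_A, h) # q)"
      using prefixes_nonpos_insert[of 0 r q] assms(3) 2(2) by blast
    ultimately show ?thesis using assms(2) by blast
  qed
qed

lemma cancel_RA_rtranclp_split:
  assumes "cancel_RA\<^sup>*\<^sup>* w w'" "w' = us @ x # vs" "suffixes_nonneg us" "prefixes_nonpos 0 vs"
  shows "\<exists>us' vs'. w = us' @ x # vs' \<and> suffixes_nonneg us' \<and> prefixes_nonpos 0 vs'"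
  using assms
proof (induction rule: converse_rtranclp_induct)
  case base
  then show ?case by blast
next
  case (step y z)
  then show ?case using cancel_RA_split by blast
qed

lemma cancel_RA_rtranclp_nonpos:
  "cancel_RA\<^sup>*\<^sup>* w w' \<Longrightarrow> prefixes_nonpos 0 w' \<Longrightarrow> prefixes_nonpos 0 w"
proof (induction rule: converse_rtranclp_induct)
  case (step y z)
  then have z: "prefixes_nonpos 0 z" by blast
  from step(1) show ?case
  proof cases
    case (1 us g h vs)
    then show ?thesis using prefixes_nonpos_insert[of 0 us vs g h] z by simp
  qed
qed

lemma no_RA_split:
  "(\<exists>p g h q. w = p @ [(Letter_R, g), (Letter_A, h)] @ q) \<or>
   (\<exists>us vs. w = us @ vs \<and> (\<forall>x\<in>set us. fst x = Letter_A) \<and> (\<forall>x\<in>set vs. fst x = Letter_R))"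
proof (induction w)
  case Nil
  then show ?case by simp
next
  case (Cons x w)
  obtain a y where x: "x = (a, y)" by fastforce
  from Cons show ?case
  proof (elim disjE exE conjE)
    fix p g h q assume "w = p @ [(Letter_R, g), (Letter_A, h)] @ q"
    then have "x # w = (x # p) @ [(Letter_R, g), (Letter_A, h)] @ q" by simp
    then show ?thesis by blast
  next
    fix us vs assume h: "w = us @ vs" "\<forall>x\<in>set us. fst x = Letter_A" "\<forall>x\<in>set vs. fst x = Letter_R"
    show ?thesis
    proof (cases a)
      case Letter_A
      then have "x # w = (x # us) @ vs" "\<forall>x\<in>set (x # us). fst x = Letter_A" using h x by auto
      then show ?thesis using h(3) by blast
    next
      case R: Letter_R
      show ?thesis
      proof (cases us)
        case Nil
        then have "x # w = [] @ (x # vs)" "\<forall>y\<in>set (x # vs). fst y = Letter_R" using h x R by auto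
        then show ?thesis by (metis empty_iff list.set(1))
      next
        case (Cons z us')
        then obtain t where "z = (Letter_A, t)" using h(2) by (cases z) auto
        then have "x # w = [] @ [(Letter_R, y), (Letter_A, t)] @ us' @ vs" using h x R Cons by simp
        then show ?thesis by blast
      qed
    qed
  qed
qed

lemma cancel_RA_normal_form:
  "\<exists>us vs. cancel_RA\<^sup>*\<^sup>* w (us @ vs) \<and> (\<forall>x\<in>set us. fst x = Letter_A) \<and> (\<forall>x\<in>set vs. fst x = Letter_R)"
proof (induction "length w" arbitrary: w rule: less_induct)
  case less
  from no_RA_split[of w] show ?case
  proof (elim disjE exE)
    fix p g h q assume w: "w = p @ [(Letter_R, g), (Letter_A, h)] @ q"
    then have "length (p @ q) < length w" by simp
    moreover have "cancel_RA w (p @ q)" unfolding w by (rule cancel_RA.intros)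
    ultimately show ?thesis using less converse_rtranclp_into_rtranclp by meson
  qed blast
qed

text \<open>In a decreasing word a threshold on positions is a cut. This translates heights of
  prefixes and suffixes into values of the potential.\<close>

lemma sorted_filter_split:
  fixes P :: "'a \<Rightarrow> int"
  assumes "sorted_wrt (\<lambda>x y. P y < P x) w"
  shows "w = filter (\<lambda>x. M \<le> P x) w @ filter (\<lambda>x. \<not> M \<le> P x) w"
  using assms
proof (induction w)
  case (Cons x w)
  show ?case
  proof (cases "M \<le> P x")
    case False
    then have "filter (\<lambda>x. M \<le> P x) (x # w) = []" using Cons.prems by (force simp: filter_empty_conv)
    moreover have "filter (\<lambda>x. \<not> M \<le> P x) (x # w) = x # w" using False Cons.prems
      by (force simp: filter_id_conv)
    ultimately show ?thesis by simp
  qed (use Cons in simp)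
qed simp

lemma sorted_filter_eq:
  fixes P :: "'a \<Rightarrow> int"
  assumes "sorted_wrt (\<lambda>x y. P y < P x) w" "x \<in> set w"
  shows "filter (\<lambda>y. P y = P x) w = [x]"
  using assms
proof (induction w)
  case (Cons z w)
  show ?case
  proof (cases "x = z")
    case True
    then have "filter (\<lambda>y. P y = P x) w = []" using Cons.prems by (force simp: filter_empty_conv)
    then show ?thesis using True by simp
  next
    case False
    then show ?thesis using Cons by force
  qed
qed simp

text \<open>The value at \<open>P x\<close> is \<open>height us + 1\<close>. Lower thresholds add
  the height of a prefix of \<open>vs\<close>, which is at most \<open>0\<close>; higher thresholds
  lose \<open>x\<close> and a suffix of \<open>us\<close> of nonnegative height.\<close>

lemma word_split_last_argmax:
  fixes P :: "letter \<times> 'a \<Rightarrow> int"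
  assumes sorted: "sorted_wrt (\<lambda>x y. P y < P x) w" and w: "w = us @ x # vs"
    and "fst x = Letter_A" "suffixes_nonneg us" "prefixes_nonpos 0 vs"
  shows "last_argmax (\<lambda>N. height (filter (\<lambda>y. N \<le> P y) w)) (P x)"
proof -
  define D where "D N = height (filter (\<lambda>y. N \<le> P y) w)" for N
  have us: "sorted_wrt (\<lambda>x y. P y < P x) us" "\<forall>y\<in>set us. P x < P y"
    and vs: "sorted_wrt (\<lambda>x y. P y < P x) vs" "\<forall>y\<in>set vs. P y < P x"
    using sorted unfolding w by (auto simp: sorted_wrt_append)
  have low: "D M = height us + 1 + height (filter (\<lambda>y. M \<le> P y) vs)" if "M \<le> P x" for M
  proof -
    have "filter (\<lambda>y. M \<le> P y) us = us" using us(2) that by (force simp: filter_id_conv)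
    then show ?thesis unfolding D_def w using that assms(3) by simp
  qed
  have "filter (\<lambda>y. P x \<le> P y) vs = []" using vs(2) by (force simp: filter_empty_conv)
  then have x: "D (P x) = height us + 1" using low[of "P x"] by simp
  have "height (filter (\<lambda>y. M \<le> P y) vs) \<le> 0" for M
    using prefixes_nonpos_height[of 0 "filter (\<lambda>y. M \<le> P y) vs" "filter (\<lambda>y. \<not> M \<le> P y) vs"] assms(5)
      sorted_filter_split[OF vs(1), of M] by simp
  then have 1: "D M \<le> D (P x)" if "M \<le> P x" for M using low[OF that] x by simp
  have 2: "D M < D (P x)" if "P x < M" for M
  proof -
    have "filter (\<lambda>y. M \<le> P y) vs = []" using vs(2) that by (force simp: filter_empty_conv)
    then have "D M = height (filter (\<lambda>y. M \<le> P y) us)" using that unfolding D_def w by simp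
    moreover have "0 \<le> height (filter (\<lambda>y. \<not> M \<le> P y) us)"
      using suffixes_nonneg_height[of "filter (\<lambda>y. M \<le> P y) us" "filter (\<lambda>y. \<not> M \<le> P y) us"]
        sorted_filter_split[OF us(1), of M] assms(4) by simp
    moreover have "height us = height (filter (\<lambda>y. M \<le> P y) us) + height (filter (\<lambda>y. \<not> M \<le> P y) us)"
      using arg_cong[OF sorted_filter_split[OF us(1), of M], of height] unfolding height_simps .
    ultimately show ?thesis using x by simp
  qed
  show ?thesis using 1 2 unfolding last_argmax_def D_def[symmetric] by (meson linorder_not_less order_less_imp_le)
qed

text \<open>From left to right, cancellations are undone around the surviving letter. Conversely,
  the rightmost \<open>A\<close> of some normal form is the last argmax by the first direction, and
  a position determines its letter.\<close>

lemma cancel_RA_last_argmax: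
  fixes P :: "letter \<times> node \<Rightarrow> int"
  assumes sorted: "sorted_wrt (\<lambda>x y. P y < P x) w"
    and s1: "\<And>x. x \<in> set w \<Longrightarrow> s (P x) = letter_value (fst x)"
    and s2: "\<And>N. s N \<noteq> 0 \<Longrightarrow> \<exists>x\<in>set w. P x = N"
  shows "(\<exists>us vs. cancel_RA\<^sup>*\<^sup>* w (us @ [(Letter_A, g)] @ vs)
        \<and> (\<forall>x\<in>set us. fst x = Letter_A) \<and> (\<forall>x\<in>set vs. fst x = Letter_R))
     \<longleftrightarrow> (Letter_A, g) \<in> set w \<and> last_argmax (potential s) (P (Letter_A, g))" (is "?L g \<longleftrightarrow> ?R g")
proof -
  define D where "D N = height (filter (\<lambda>y. N \<le> P y) w)" for N
  have add: "height (filter Q w) = height (filter (\<lambda>y. Q y \<and> S y) w) + height (filter (\<lambda>y. Q y \<and> \<not> S y) w)" for Q S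
    by (induction w) auto
  have "D N = D (N + 1) + s N" for N
  proof -
    have "height (filter (\<lambda>y. P y = N) w) = s N"
    proof (cases "\<exists>x\<in>set w. P x = N")
      case True
      then obtain x where "x \<in> set w" "P x = N" by blast
      then show ?thesis using sorted_filter_eq[OF sorted, of x] s1[of x] by simp
    next
      case False
      then have "filter (\<lambda>y. P y = N) w = []" by (auto simp: filter_empty_conv)
      then show ?thesis using s2 False by fastforce
    qed
    moreover have "(\<lambda>y. N \<le> P y \<and> N + 1 \<le> P y) = (\<lambda>y. N + 1 \<le> P y)"
      "(\<lambda>y. N \<le> P y \<and> \<not> N + 1 \<le> P y) = (\<lambda>y. P y = N)" by auto
    ultimately show ?thesis using add[of "\<lambda>y. N \<le> P y" "\<lambda>y. N + 1 \<le> P y"] by (simp add: D_def)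
  qed
  then have D: "is_potential s D" unfolding is_potential_def by blast
  note iff = last_argmax_is_potential[OF is_potential_potential D]
  have LR: "?R g" if L: "?L g" for g
  proof -
    obtain us vs where "cancel_RA\<^sup>*\<^sup>* w (us @ (Letter_A, g) # vs)"
      "\<forall>x\<in>set us. fst x = Letter_A" "\<forall>x\<in>set vs. fst x = Letter_R" using L by auto
    then obtain us' vs' where "w = us' @ (Letter_A, g) # vs'" "suffixes_nonneg us'" "prefixes_nonpos 0 vs'"
      using cancel_RA_rtranclp_split suffixes_nonneg_A prefixes_nonpos_R by (metis order_refl)
    then have "last_argmax D (P (Letter_A, g))" "(Letter_A, g) \<in> set w"
      using word_split_last_argmax[OF sorted, of us' "(Letter_A, g)" vs'] unfolding D_def by auto
    then show ?thesis using iff by blast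
  qed
  have "?L g" if R: "?R g"
  proof -
    obtain us vs where n: "cancel_RA\<^sup>*\<^sup>* w (us @ vs)"
      "\<forall>x\<in>set us. fst x = Letter_A" "\<forall>x\<in>set vs. fst x = Letter_R"
      using cancel_RA_normal_form by blast
    show ?thesis
    proof (cases us rule: rev_cases)
      case Nil
      \<comment> \<open>If no \<open>A\<close> survives, the potential is nowhere positive, yet it
        is \<open>0\<close> beyond all letters. So its last argmax cannot lie at the position of a
        letter.\<close>
      then have "prefixes_nonpos 0 w" using n prefixes_nonpos_R cancel_RA_rtranclp_nonpos by fastforce
      then have "D M \<le> 0" for M
        using prefixes_nonpos_height[of 0 "filter (\<lambda>y. M \<le> P y) w" "filter (\<lambda>y. \<not> M \<le> P y) w"]
          sorted_filter_split[OF sorted, of M] by (simp add: D_def)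
      moreover define M where "M = Max (P ` set w) + 1"
      have M: "P y < M" if "y \<in> set w" for y using that by (simp add: M_def zle_add1_eq_le)
      then have "filter (\<lambda>y. M \<le> P y) w = []" by (force simp: filter_empty_conv)
      then have "D M = 0" by (simp add: D_def)
      moreover have "P (Letter_A, g) < M" using M R by blast
      moreover have "last_argmax D (P (Letter_A, g))" using R iff by blast
      ultimately show ?thesis unfolding last_argmax_def by (metis not_less)
    next
      case (snoc us' x)
      then obtain g' where g': "x = (Letter_A, g')" using n(2) by (cases x) auto
      then have "cancel_RA\<^sup>*\<^sup>* w (us' @ [(Letter_A, g')] @ vs)" using n(1) snoc by simp
      then have "?L g'" using n snoc by (metis Un_iff set_append)
      then have g'R: "?R g'" using LR by blast
      then have eq: "P (Letter_A, g') = P (Letter_A, g)" using R last_argmax_unique by blast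
      have "filter (\<lambda>y. P y = P (Letter_A, g)) w = [(Letter_A, g)]"
        using sorted_filter_eq[OF sorted] R by blast
      moreover have "filter (\<lambda>y. P y = P (Letter_A, g)) w = [(Letter_A, g')]"
        using sorted_filter_eq[OF sorted, of "(Letter_A, g')"] g'R unfolding eq by blast
      ultimately have "g' = g" by (metis list.inject prod.inject)
      then show ?thesis using \<open>?L g'\<close> by blast
    qed
  qed
  then show ?thesis using LR by blast
qed

subsection \<open>Beads of multipartitions\<close>

text \<open>Padding with rows of length \<open>0\<close> gives each component infinitely many rows,
  so even an empty component carries a half line of beads.\<close>

definition rows :: "mpart \<Rightarrow> nat \<Rightarrow> nat \<Rightarrow> nat" where
  "rows lam c a = (if c < length lam \<and> a < length (lam ! c) then lam ! c ! a else 0)"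

text \<open>Row indices start at \<open>0\<close> here. The bead of a row lies one to the right of the usual beta-number,
  so that it agrees with the content of the node that can be added to this row.\<close>

definition beads_of :: "int list \<Rightarrow> mpart \<Rightarrow> beads" where
  "beads_of s lam c j \<longleftrightarrow> c < length s \<and> (\<exists>a. j = int (rows lam c a) - int a + s ! c)"

lemma in_nodes_iff: "(a, b, c) \<in> nodes lam \<longleftrightarrow> 1 \<le> a \<and> 1 \<le> b \<and> b \<le> rows lam c (a - 1)"
  by (auto simp: nodes_def rows_def)

lemma rows_pos_iff:
  assumes "lam \<in> multipartitions l"
  shows "0 < rows lam c a \<longleftrightarrow> c < l \<and> a < length (lam ! c)"
proof -
  have len: "length lam = l" and part: "\<And>xs. xs \<in> set lam \<Longrightarrow> partition xs"
    using assms by (auto simp: multipartitions_def)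
  have "1 \<le> lam ! c ! a" if "c < l" "a < length (lam ! c)"
    using part[of "lam ! c"] that len by (simp add: partition_def)
  then show ?thesis using len by (auto simp: rows_def)
qed

lemma rows_antimono:
  assumes "lam \<in> multipartitions l" "a \<le> a'"
  shows "rows lam c a' \<le> rows lam c a"
proof (cases "a = a' \<or> \<not> (c < l \<and> a' < length (lam ! c))")
  case False
  then have "sorted_wrt (\<ge>) (lam ! c)" "c < length lam"
    using assms(1) by (auto simp: multipartitions_def partition_def)
  then show ?thesis using False assms(2) by (auto simp: rows_def sorted_wrt_iff_nth_less)
qed (use assms in \<open>auto simp: rows_def multipartitions_def\<close>)

lemma rows_inj:
  assumes "lam \<in> multipartitions l" "mu \<in> multipartitions l" "rows lam = rows mu"
  shows "lam = mu"
proof (rule nth_equalityI)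
  show len: "length lam = length mu" using assms by (simp add: multipartitions_def)
  fix c assume c: "c < length lam"
  then have cl: "c < l" using assms(1) by (simp add: multipartitions_def)
  have iff: "a < length (lam ! c) \<longleftrightarrow> a < length (mu ! c)" for a
    using rows_pos_iff[OF assms(1), of c a] rows_pos_iff[OF assms(2), of c a] assms(3) cl by simp
  show "lam ! c = mu ! c"
  proof (rule nth_equalityI)
    show "length (lam ! c) = length (mu ! c)" using iff by (meson linorder_neqE_nat less_irrefl)
    fix a assume a: "a < length (lam ! c)"
    have "rows lam c a = rows mu c a" using assms(3) by simp
    then show "lam ! c ! a = mu ! c ! a" using a iff c len by (simp add: rows_def)
  qed
qed

lemma partition_of_rows:
  assumes anti: "\<And>a. f (Suc a) \<le> f a" and n: "f n = (0::nat)"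
  shows "\<exists>xs. partition xs \<and> (\<forall>a. (if a < length xs then xs ! a else 0) = f a)"
proof -
  define m where "m = (LEAST n. f n = 0)"
  have m: "f m = 0" "\<And>a. a < m \<Longrightarrow> f a \<noteq> 0"
    using LeastI[of "\<lambda>n. f n = 0", OF n] not_less_Least unfolding m_def by auto
  have le: "f b \<le> f a" if "a \<le> b" for a b using anti lift_Suc_antimono_le[of f] that by blast
  let ?xs = "map f [0..<m]"
  have "partition ?xs" using le m(2) by (auto simp: partition_def sorted_wrt_iff_nth_less Suc_le_eq)
  moreover have "(if a < length ?xs then ?xs ! a else 0) = f a" for a
    using m(1) le[of m a] by simp
  ultimately show ?thesis by blast
qed

text \<open>Together with \<open>rows_inj\<close> this allows multipartitions to be built and
  compared through their row lengths.\<close>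

lemma rows_exists:
  assumes "\<And>c a. f c (Suc a) \<le> f c a" "\<And>c. \<exists>n. f c n = 0" "\<And>c a. l \<le> c \<Longrightarrow> f c a = 0"
  shows "\<exists>lam\<in>multipartitions l. rows lam = f"
proof -
  have "\<exists>xs. partition xs \<and> (\<forall>a. (if a < length xs then xs ! a else 0) = f c a)" for c
    using partition_of_rows[of "f c"] assms by blast
  then obtain part where part: "\<And>c. partition (part c)" "\<And>c a. (if a < length (part c) then part c ! a else 0) = f c a"
    by metis
  let ?lam = "map part [0..<l]"
  have "rows ?lam c a = f c a" for c a
  proof (cases "c < l")
    case True
    then show ?thesis using part(2)[where c = c and a = a] by (simp add: rows_def split: if_splits)
  next
    case False
    then show ?thesis using assms(3)[of c a] by (simp add: rows_def)
  qed
  moreover have "?lam \<in> multipartitions l" using part(1) by (auto simp: multipartitions_def)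
  ultimately show ?thesis by blast
qed

section \<open>Adding a box as a hop of a bead\<close>

definition add_box :: "(nat \<Rightarrow> nat \<Rightarrow> nat) \<Rightarrow> nat \<Rightarrow> nat \<Rightarrow> nat \<Rightarrow> nat \<Rightarrow> nat" where
  "add_box r c a = r(c := (r c)(a := Suc (r c a)))"

text \<open>The nodes of a row form an initial segment of columns, so a single new node lengthens
  one row by one. Rows of nodes count from \<open>1\<close> and rows here from \<open>0\<close>,
  hence \<open>Suc a\<close>.\<close>

lemma nodes_insert_iff:
  assumes "lam \<in> multipartitions l" "mu \<in> multipartitions l"
  shows "nodes mu = insert g (nodes lam) \<and> g \<notin> nodes lam \<longleftrightarrow>
    (\<exists>c a. g = (Suc a, Suc (rows lam c a), c) \<and> rows mu = add_box (rows lam) c a)"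
proof
  assume h: "nodes mu = insert g (nodes lam) \<and> g \<notin> nodes lam"
  obtain a' b c where g: "g = (a', b, c)" by (cases g)
  have "g \<in> nodes mu" using h by simp
  then obtain a where a: "a' = Suc a" "1 \<le> b" using g in_nodes_iff by (cases a') auto
  have iff: "1 \<le> y \<Longrightarrow> y \<le> rows mu d x \<longleftrightarrow> (x, y, d) = (a, b, c) \<or> y \<le> rows lam d x" for x y d
    using h in_nodes_iff[of "Suc x" y d mu] in_nodes_iff[of "Suc x" y d lam] g a by auto
  have nb: "\<not> b \<le> rows lam c a" using h g a in_nodes_iff[of "Suc a" b c lam] by auto
  have "rows mu d x = rows lam d x" if "(d, x) \<noteq> (c, a)" for d x
  proof -
    have "1 \<le> y \<Longrightarrow> y \<le> rows mu d x \<longleftrightarrow> y \<le> rows lam d x" for y using iff[of y d x] that by auto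
    from this[of "rows mu d x"] this[of "rows lam d x"] show ?thesis by linarith
  qed
  moreover have "b \<le> rows mu c a" using iff[OF a(2), of c a] by simp
  have "b = Suc (rows lam c a)"
  proof (cases "b = 1")
    case False
    then have "1 \<le> b - 1" "b - 1 \<noteq> b" using a(2) by auto
    \<comment> \<open>Column \<open>b - 1\<close> lies in the row of \<open>mu\<close> without being
      the new node, so it was there before.\<close>
    then have "b - 1 \<le> rows lam c a" using iff[of "b - 1" c a] \<open>b \<le> rows mu c a\<close> by auto
    then show ?thesis using nb by linarith
  qed (use nb in simp)
  moreover have "rows mu c a = b"
    using iff[of "rows mu c a" c a] nb \<open>b \<le> rows mu c a\<close> a(2) by auto
  ultimately have "rows mu = add_box (rows lam) c a" "b = Suc (rows lam c a)"
    by (auto simp: add_box_def fun_eq_iff)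
  then show "\<exists>c a. g = (Suc a, Suc (rows lam c a), c) \<and> rows mu = add_box (rows lam) c a"
    using g a by blast
next
  assume "\<exists>c a. g = (Suc a, Suc (rows lam c a), c) \<and> rows mu = add_box (rows lam) c a"
  then obtain c a where g: "g = (Suc a, Suc (rows lam c a), c)" and mu: "rows mu = add_box (rows lam) c a"
    by blast
  have "x \<in> nodes mu \<longleftrightarrow> x \<in> insert g (nodes lam)" for x
  proof (cases x)
    case (fields x1 y d)
    then show ?thesis
      by (cases x1) (auto simp: in_nodes_iff g mu add_box_def)
  qed
  then show "nodes mu = insert g (nodes lam) \<and> g \<notin> nodes lam" by (auto simp: g in_nodes_iff)
qed

lemma finite_nodes_card_nodes:
  "finite (nodes lam)" "card (nodes lam) = rank lam"
proof -
  let ?f = "\<lambda>(c, a, b). (Suc a, Suc b, c)"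
  let ?S = "SIGMA c:{..<length lam}. SIGMA a:{..<length (lam ! c)}. {..<lam ! c ! a}"
  have nodes: "nodes lam = ?f ` ?S"
  proof (intro Set.set_eqI iffI)
    fix x assume "x \<in> nodes lam"
    then obtain a b c where x: "x = (Suc a, Suc b, c)" "c < length lam" "a < length (lam ! c)" "b < lam ! c ! a"
      unfolding nodes_def by (auto simp: Suc_le_eq) (metis Suc_diff_1 diff_less less_le_trans less_one less_eq_Suc_le not_less_eq)
    then have "(c, a, b) \<in> ?S" "x = ?f (c, a, b)" by auto
    then show "x \<in> ?f ` ?S" by blast
  qed (auto simp: nodes_def)
  have "inj_on ?f ?S" by (auto simp: inj_on_def)
  then have "card (nodes lam) = card ?S" unfolding nodes by (rule card_image)
  also have "\<dots> = rank lam" by (simp add: rank_def sum_list_sum_nth atLeast0LessThan)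
  finally show "card (nodes lam) = rank lam" .
  show "finite (nodes lam)" unfolding nodes by (intro finite_imageI finite_SigmaI) auto
qed

lemma strict_decreasing_eqI:
  fixes u v :: "nat \<Rightarrow> int"
  assumes "\<And>a b. a < b \<Longrightarrow> u b < u a" "\<And>a b. a < b \<Longrightarrow> v b < v a" "range u = range v"
  shows "u = v"
proof
  fix n
  show "u n = v n"
  proof (induction n rule: less_induct)
    case (less n)
    obtain m where m: "u n = v m" using assms(3) by (metis rangeE rangeI)
    obtain k where k: "v n = u k" using assms(3) by (metis rangeE rangeI)
    have "n \<le> m" using less[of m] assms(1)[of m n] m by (metis less_irrefl not_less)
    moreover have "n \<le> k" using less[of k] assms(2)[of k n] k by (metis less_irrefl not_less)
    ultimately show ?case using assms(1)[of n k] assms(2)[of n m] m k by (metis le_less less_asym)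
  qed
qed

text \<open>Listed by rows, the beads of a component form a strictly decreasing sequence, which is
  determined by its set of values.\<close>

lemma beads_of_inj:
  assumes "lam \<in> multipartitions (length s)" "mu \<in> multipartitions (length s)"
    "beads_of s lam = beads_of s mu"
  shows "lam = mu"
proof (rule rows_inj[OF assms(1,2)], intro ext)
  fix c a
  show "rows lam c a = rows mu c a"
  proof (cases "c < length s")
    case True
    let ?u = "\<lambda>lam a. int (rows lam c a) - int a + s ! c"
    have "j \<in> range (?u lam) \<longleftrightarrow> j \<in> range (?u mu)" for j
      using fun_cong[OF fun_cong[OF assms(3), of c], of j] True by (auto simp: beads_of_def)
    then have "range (?u lam) = range (?u mu)" by blast
    moreover have "?u lam b < ?u lam a" "?u mu b < ?u mu a" if "a < b" for a b
      using rows_antimono[OF assms(1), of a b c] rows_antimono[OF assms(2), of a b c] that by auto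
    ultimately have "?u lam = ?u mu" by (intro strict_decreasing_eqI)
    then have "?u lam a = ?u mu a" by (rule fun_cong)
    then show ?thesis by simp
  next
    case False
    then show ?thesis using rows_pos_iff[OF assms(1)] rows_pos_iff[OF assms(2)] by (metis neq0_conv)
  qed
qed

lemma beads_of_add_box:
  assumes lam: "lam \<in> multipartitions (length s)" and mu: "mu \<in> multipartitions (length s)"
    and r: "rows mu = add_box (rows lam) c a" and j: "j = int (rows lam c a) - int a + s ! c"
  shows "c < length s" "beads_of s lam c j" "\<not> beads_of s lam c (j + 1)" "beads_of s mu = hop (beads_of s lam) c j"
    "\<not> beads_of s mu c j" "beads_of s mu c (j + 1)"
proof -
  have "rows mu c a = Suc (rows lam c a)" by (simp add: r add_box_def)
  then show c: "c < length s" using rows_pos_iff[OF mu, of c a] by simp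
  show B: "beads_of s lam c j" using c j by (auto simp: beads_of_def)
  let ?u = "\<lambda>lam a. int (rows lam c a) - int a + s ! c"
  have u: "?u lam b < ?u lam a" "?u mu b < ?u mu a" if "a < b" for a b
    using rows_antimono[OF lam, of a b c] rows_antimono[OF mu, of a b c] that by auto
  have mu_eq: "?u mu b = (if b = a then j + 1 else ?u lam b)" for b
    by (simp add: r add_box_def j)
  \<comment> \<open>A bead at \<open>j + 1\<close> would belong to a higher row and would collide
    with the bead of the lengthened row in \<open>mu\<close>.\<close>
  have ne: "?u lam b \<noteq> j + 1" for b
  proof (cases b a rule: linorder_cases)
    case less
    then show ?thesis using u(2)[OF less] mu_eq[of a] mu_eq[of b] by simp
  next
    case equal
    then show ?thesis by (simp add: j)
  next
    case greater
    then show ?thesis using u(1)[OF greater] by (simp add: j)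
  qed
  then show nB: "\<not> beads_of s lam c (j + 1)" by (force simp: beads_of_def)
  have ne2: "?u lam b \<noteq> j" if "b \<noteq> a" for b
    using that u(1)[of a b] u(1)[of b a] j by (metis linorder_neqE_nat less_irrefl)
  show hop: "beads_of s mu = hop (beads_of s lam) c j"
  proof (intro ext iffI)
    fix c' j'
    assume h: "beads_of s mu c' j'"
    show "hop (beads_of s lam) c j c' j'"
    proof (cases "c' = c")
      case True
      then obtain b where "j' = ?u mu b" using h by (auto simp: beads_of_def)
      then show ?thesis using True mu_eq[of b] ne2[of b] c
        by (auto simp: hop_def beads_of_def split: if_splits)
    qed (use h in \<open>auto simp: hop_def beads_of_def r add_box_def\<close>)
  next
    fix c' j'
    assume h: "hop (beads_of s lam) c j c' j'"
    show "beads_of s mu c' j'"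
    proof (cases "c' = c")
      case True
      then consider "j' = j + 1" | b where "j' = ?u lam b" "j' \<noteq> j" "j' \<noteq> j + 1"
        using h by (auto simp: hop_def beads_of_def split: if_splits)
      then show ?thesis
      proof cases
        case 1
        then show ?thesis using mu_eq[of a] True c unfolding beads_of_def by metis
      next
        case 2
        then have "b \<noteq> a" using j by auto
        then show ?thesis using mu_eq[of b] 2 True c unfolding beads_of_def by metis
      qed
    qed (use h in \<open>auto simp: hop_def beads_of_def r add_box_def\<close>)
  qed
  show "\<not> beads_of s mu c j" "beads_of s mu c (j + 1)" unfolding hop by (auto simp: hop_def)
qed

text \<open>That \<open>j + 1\<close> is free means that the row just above \<open>a\<close>, if
  any, is strictly longer; this is exactly when row \<open>a\<close> may grow.\<close>

lemma beads_of_hop_exists: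
  assumes lam: "lam \<in> multipartitions (length s)"
    and B: "beads_of s lam c j" "\<not> beads_of s lam c (j + 1)"
  shows "\<exists>mu\<in>multipartitions (length s). \<exists>a. rows mu = add_box (rows lam) c a
           \<and> j = int (rows lam c a) - int a + s ! c"
proof -
  obtain a where c: "c < length s" and a: "j = int (rows lam c a) - int a + s ! c"
    using B(1) by (auto simp: beads_of_def)
  have anti: "add_box (rows lam) c a d (Suc x) \<le> add_box (rows lam) c a d x" for d x
  proof (cases "d = c \<and> Suc x = a")
    case True
    have "j + 1 \<noteq> int (rows lam c x) - int x + s ! c" using B(2) c unfolding beads_of_def by blast
    then have "rows lam c a \<noteq> rows lam c x" using True a by auto
    then show ?thesis using True rows_antimono[OF lam, of x a c] by (auto simp: add_box_def)
  next
    case False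
    then show ?thesis using rows_antimono[OF lam, of x "Suc x" d] by (auto simp: add_box_def)
  qed
  have "\<exists>n. add_box (rows lam) c a d n = 0" for d
  proof -
    have "rows lam d (Suc (max a (length (lam ! d)))) = 0" by (simp add: rows_def max_def)
    then have "add_box (rows lam) c a d (Suc (max a (length (lam ! d)))) = 0"
      by (auto simp: add_box_def)
    then show ?thesis ..
  qed
  moreover have "add_box (rows lam) c a d x = 0" if "length s \<le> d" for d x
    using that c rows_pos_iff[OF lam, of d x] by (auto simp: add_box_def)
  ultimately show ?thesis using rows_exists[of "add_box (rows lam) c a" "length s"] anti a by blast
qed

lemma beads_of_unhop_exists:
  assumes mu: "mu \<in> multipartitions (length s)"
    and B: "\<not> beads_of s mu c j" "beads_of s mu c (j + 1)"
  shows "\<exists>lam\<in>multipartitions (length s). \<exists>a. rows mu = add_box (rows lam) c a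
           \<and> j = int (rows lam c a) - int a + s ! c"
proof -
  obtain a where c: "c < length s" and a: "j + 1 = int (rows mu c a) - int a + s ! c"
    using B(2) by (auto simp: beads_of_def)
  \<comment> \<open>If the row below were as long as row \<open>a\<close>, its bead would lie at
    \<open>j\<close>. So it is shorter, and row \<open>a\<close> can lose a box.\<close>
  have "j \<noteq> int (rows mu c (Suc a)) - int (Suc a) + s ! c" using B(1) c unfolding beads_of_def by blast
  then have lt: "rows mu c (Suc a) < rows mu c a"
    using a rows_antimono[OF mu, of a "Suc a" c] by (cases "rows mu c (Suc a) = rows mu c a") auto
  define f where "f = (rows mu)(c := (rows mu c)(a := rows mu c a - 1))"
  have anti: "f d (Suc x) \<le> f d x" for d x
    using rows_antimono[OF mu, of x "Suc x" d] lt by (auto simp: f_def)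
  have "\<exists>n. f d n = 0" for d
  proof -
    have "rows mu d (Suc (max a (length (mu ! d)))) = 0" by (simp add: rows_def max_def)
    then have "f d (Suc (max a (length (mu ! d)))) = 0" by (auto simp: f_def)
    then show ?thesis ..
  qed
  moreover have "f d x = 0" if "length s \<le> d" for d x
    using that c rows_pos_iff[OF mu, of d x] by (auto simp: f_def)
  ultimately obtain lam where lam: "lam \<in> multipartitions (length s)" "rows lam = f"
    using rows_exists[of f "length s"] anti by blast
  have "rows mu = add_box (rows lam) c a" using lt unfolding lam(2) by (auto simp: f_def add_box_def fun_eq_iff)
  moreover have "j = int (rows lam c a) - int a + s ! c" using lt a unfolding lam(2) by (simp add: f_def)
  ultimately show ?thesis using lam(1) by blast
qed

section \<open>Addable and removable nodes read off the beads\<close>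

lemma addable_iff:
  assumes "lam \<in> multipartitions l"
  shows "addable lam g \<longleftrightarrow> (\<exists>mu\<in>multipartitions l. \<exists>c a.
    g = (Suc a, Suc (rows lam c a), c) \<and> rows mu = add_box (rows lam) c a)"
proof -
  have "length lam = l" using assms by (simp add: multipartitions_def)
  then have "addable lam g \<longleftrightarrow> (\<exists>mu\<in>multipartitions l. nodes mu = insert g (nodes lam) \<and> g \<notin> nodes lam)"
    by (auto simp: addable_def)
  then show ?thesis using nodes_insert_iff[OF assms] by blast
qed

lemma removable_iff:
  assumes "lam \<in> multipartitions l"
  shows "removable lam g \<longleftrightarrow> (\<exists>nu\<in>multipartitions l. \<exists>c a.
    g = (Suc a, Suc (rows nu c a), c) \<and> rows lam = add_box (rows nu) c a)"
proof -
  have len: "length lam = l" using assms by (simp add: multipartitions_def)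
  have "g \<in> nodes lam \<and> nodes nu = nodes lam - {g} \<longleftrightarrow> nodes lam = insert g (nodes nu) \<and> g \<notin> nodes nu" for nu
    by auto
  then have "removable lam g \<longleftrightarrow> (\<exists>nu\<in>multipartitions l. nodes lam = insert g (nodes nu) \<and> g \<notin> nodes nu)"
    unfolding removable_def len by blast
  then show ?thesis using nodes_insert_iff[OF _ assms] by blast
qed

lemma finite_addable:
  assumes "lam \<in> multipartitions l"
  shows "finite {g. addable lam g}"
proof -
  have len: "length lam = l" using assms by (simp add: multipartitions_def)
  have "{g. addable lam g} \<subseteq> (\<lambda>(c, a). (Suc a, Suc (rows lam c a), c)) `
      (SIGMA c:{..<length lam}. {..length (lam ! c)})"
  proof
    fix g assume "g \<in> {g. addable lam g}"
    then obtain mu c a where mu: "mu \<in> multipartitions l"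
      and g: "g = (Suc a, Suc (rows lam c a), c)" and r: "rows mu = add_box (rows lam) c a"
      using addable_iff[OF assms] by blast
    have "rows mu c a > 0" by (simp add: r add_box_def)
    then have c: "c < length lam" using rows_pos_iff[OF mu] len by blast
    \<comment> \<open>A box below the first empty row would leave a gap in
      \<open>mu\<close>.\<close>
    have "a \<le> length (lam ! c)"
    proof (rule ccontr)
      assume "\<not> a \<le> length (lam ! c)"
      then have "rows mu c (length (lam ! c)) = 0" by (simp add: r add_box_def rows_def)
      then show False
        using rows_antimono[OF mu, of "length (lam ! c)" a c] \<open>\<not> a \<le> length (lam ! c)\<close> \<open>rows mu c a > 0\<close> by simp
    qed
    then show "g \<in> (\<lambda>(c, a). (Suc a, Suc (rows lam c a), c)) `
      (SIGMA c:{..<length lam}. {..length (lam ! c)})" using c g by force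
  qed
  then show ?thesis by (rule finite_subset) auto
qed

lemma addable_beads:
  assumes lam: "lam \<in> multipartitions (length s)" and "addable lam g"
  shows "component g < length s" "beads_of s lam (component g) (content s g)"
    "\<not> beads_of s lam (component g) (content s g + 1)"
    "\<exists>a. g = (Suc a, Suc (rows lam (component g) a), component g)"
    "mu \<in> multipartitions (length s) \<Longrightarrow> nodes mu = insert g (nodes lam) \<Longrightarrow>
      beads_of s mu = hop (beads_of s lam) (component g) (content s g)"
proof -
  obtain mu c a where mu: "mu \<in> multipartitions (length s)"
    and g: "g = (Suc a, Suc (rows lam c a), c)" and r: "rows mu = add_box (rows lam) c a"
    using addable_iff[OF lam] assms(2) by blast
  have ct: "content s g = int (rows lam c a) - int a + s ! c" "component g = c" by (simp_all add: g)
  note b = beads_of_add_box[OF lam mu r ct(1)]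
  show "component g < length s" "beads_of s lam (component g) (content s g)"
    "\<not> beads_of s lam (component g) (content s g + 1)" using b ct by auto
  show "\<exists>a. g = (Suc a, Suc (rows lam (component g) a), component g)" using g by auto
  fix mu' assume mu': "mu' \<in> multipartitions (length s)" "nodes mu' = insert g (nodes lam)"
  have "g \<notin> nodes lam" using g by (simp add: in_nodes_iff)
  then obtain c' a' where "g = (Suc a', Suc (rows lam c' a'), c')" "rows mu' = add_box (rows lam) c' a'"
    using nodes_insert_iff[OF lam mu'(1)] mu'(2) by blast
  then show "beads_of s mu' = hop (beads_of s lam) (component g) (content s g)"
    using beads_of_add_box(4)[OF lam mu'(1), of c' a' "content s g"] g by simp
qed

text \<open>The bead of the row that ends in \<open>g\<close> lies one to the right of the content
  of \<open>g\<close>; after deletion of \<open>g\<close> it would lie at that content.\<close>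

lemma removable_beads:
  assumes lam: "lam \<in> multipartitions (length s)" and "removable lam g"
  shows "component g < length s" "\<not> beads_of s lam (component g) (content s g)"
    "beads_of s lam (component g) (content s g + 1)"
    "\<exists>a. g = (Suc a, rows lam (component g) a, component g)"
proof -
  obtain nu c a where nu: "nu \<in> multipartitions (length s)"
    and g: "g = (Suc a, Suc (rows nu c a), c)" and r: "rows lam = add_box (rows nu) c a"
    using removable_iff[OF lam] assms(2) by blast
  have ct: "content s g = int (rows nu c a) - int a + s ! c" "component g = c" by (simp_all add: g)
  note b = beads_of_add_box[OF nu lam r ct(1)]
  show "component g < length s" "\<not> beads_of s lam (component g) (content s g)"
    "beads_of s lam (component g) (content s g + 1)" using b ct by auto
  show "\<exists>a. g = (Suc a, rows lam (component g) a, component g)" using g r by (auto simp: add_box_def)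
qed

lemma row_content_inj:
  assumes "lam \<in> multipartitions l" "int (rows lam c a) - int a = int (rows lam c a') - int a'"
  shows "a = a'"
  using rows_antimono[OF assms(1), of a a' c] rows_antimono[OF assms(1), of a' a c] assms(2)
  by (cases "a \<le> a'") auto

lemma position_less_iff:
  assumes "e > 0" "c < l" "c' < l" "int e dvd j - int i" "int e dvd j' - int i"
  shows "position e l i c j < position e l i c' j' \<longleftrightarrow> j < j' \<or> j = j' \<and> c < c'"
proof -
  obtain q q' where q: "j - int i = int e * q" "j' - int i = int e * q'" using assms by (auto elim!: dvdE)
  have n: "position e l i c j = q * int l + int c" "position e l i c' j' = q' * int l + int c'"
    using q assms(1) by (simp_all add: position_def)
  have lt: "q * int l + int c < q' * int l + int c'" if "q < q'" "c < l" "c' < l" for q q' c c'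
  proof -
    have "(q + 1) * int l \<le> q' * int l" using that by (intro mult_right_mono) auto
    then show ?thesis using that by (simp add: algebra_simps)
  qed
  have "j < j' \<longleftrightarrow> q < q'"
  proof -
    have "j < j' \<longleftrightarrow> int e * q < int e * q'" using q by linarith
    then show ?thesis using assms(1) by simp
  qed
  moreover have "j = j' \<longleftrightarrow> q = q'"
  proof -
    have "j = j' \<longleftrightarrow> int e * q = int e * q'" using q by linarith
    then show ?thesis using assms(1) by simp
  qed
  moreover have "q < q' \<or> q = q' \<or> q' < q" by linarith
  ultimately show ?thesis using lt[of q q' c c'] lt[of q' q c' c] assms(2,3) unfolding n by auto
qed

lemma sorted_word_exists:
  fixes P :: "'a \<Rightarrow> int"
  assumes "finite S" "inj_on P S"
  shows "\<exists>w. set w = S \<and> distinct w \<and> sorted_wrt (\<lambda>x y. P y < P x) w"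
proof -
  let ?L = "rev (sorted_list_of_set (P ` S))"
  let ?w = "map (inv_into S P) ?L"
  have fin: "finite (P ` S)" using assms(1) by simp
  have inv: "x \<in> P ` S \<Longrightarrow> P (inv_into S P x) = x" for x by (rule f_inv_into_f)
  have "set ?w = S" using fin assms(2) by (simp add: image_image inv_into_f_f cong: image_cong)
  moreover have "sorted_wrt (\<lambda>x y. y < x) ?L"
    using strict_sorted_list_of_set[of "P ` S"] by (simp add: sorted_wrt_rev)
  then have "sorted_wrt (\<lambda>x y. P y < P x) ?w"
    unfolding sorted_wrt_map by (rule sorted_wrt_mono_rel[rotated]) (use inv fin in auto)
  moreover have "distinct ?w"
    using fin by (simp add: distinct_map inj_on_inv_into)
  ultimately show ?thesis by blast
qed

section \<open>Words of a multipartition and its signature\<close>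

definition word_pos :: "nat \<Rightarrow> int list \<Rightarrow> nat \<Rightarrow> letter \<times> node \<Rightarrow> int" where
  "word_pos e s i x = position e (length s) i (component (snd x)) (content s (snd x))"

lemma i_node_dvd: "i_node e s i g \<longleftrightarrow> int e dvd content s g - int i"
  by (simp add: i_node_def cong_iff_dvd_diff)

context
  fixes e i :: nat and s :: "int list" and lam :: mpart
  assumes e: "2 \<le> e" and lam: "lam \<in> multipartitions (length s)"
begin

abbreviation (input) "letters \<equiv> {(Letter_A, g) | g. addable lam g \<and> i_node e s i g}
             \<union> {(Letter_R, g) | g. removable lam g \<and> i_node e s i g}"

lemma letter_beads:
  assumes "x \<in> letters"
  shows "component (snd x) < length s" "int e dvd content s (snd x) - int i"
    "signature e (length s) i (beads_of s lam) (word_pos e s i x) = letter_value (fst x)"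
proof -
  show c: "component (snd x) < length s" and d: "int e dvd content s (snd x) - int i"
    using assms addable_beads(1)[OF lam] removable_beads(1)[OF lam] by (auto simp: i_node_dvd)
  show "signature e (length s) i (beads_of s lam) (word_pos e s i x) = letter_value (fst x)"
    unfolding word_pos_def signature_position[OF c d]
    using assms addable_beads(2,3)[OF lam] removable_beads(2,3)[OF lam] by auto
qed

text \<open>The signature at a position tells \<open>A\<close> from \<open>R\<close>. Component and
  content then determine the row, since the beads of different rows are distinct.\<close>

lemma word_pos_inj: "inj_on (word_pos e s i) letters"
proof (rule inj_onI)
  fix x y assume x: "x \<in> letters" and y: "y \<in> letters" and eq: "word_pos e s i x = word_pos e s i y"
  have cj: "component (snd x) = component (snd y)" "content s (snd x) = content s (snd y)"
    using letter_beads(1,2)[OF x] letter_beads(1,2)[OF y] eq unfolding word_pos_def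
    by (metis pos_component_position, metis pos_content_position)
  have "letter_value (fst x) = letter_value (fst y)" using letter_beads(3)[OF x] letter_beads(3)[OF y] eq by simp
  then have f: "fst x = fst y" by (cases "fst x"; cases "fst y") auto
  obtain c where c: "component (snd x) = c" "component (snd y) = c" using cj by simp
  have "snd x = snd y"
  proof (cases "fst x")
    case Letter_A
    then have "addable lam (snd x)" "addable lam (snd y)" using x y f by auto
    then obtain a b where "snd x = (Suc a, Suc (rows lam c a), c)" "snd y = (Suc b, Suc (rows lam c b), c)"
      using addable_beads(4)[OF lam] c by metis
    then show ?thesis using cj(2) row_content_inj[OF lam, of c a b] by auto
  next
    case Letter_R
    then have "removable lam (snd x)" "removable lam (snd y)" using x y f by auto
    then obtain a b where "snd x = (Suc a, rows lam c a, c)" "snd y = (Suc b, rows lam c b, c)"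
      using removable_beads(4)[OF lam] c by metis
    then show ?thesis using cj(2) row_content_inj[OF lam, of c a b] by auto
  qed
  then show "x = y" using f by (simp add: prod_eq_iff)
qed

lemma letter_exists:
  assumes "signature e (length s) i (beads_of s lam) N \<noteq> 0"
  shows "\<exists>x\<in>letters. word_pos e s i x = N"
proof -
  define c j where "c = pos_component (length s) N" and "j = pos_content e (length s) i N"
  have signature: "signature e (length s) i (beads_of s lam) N = of_bool (beads_of s lam c j) - of_bool (beads_of s lam c (j + 1))"
    by (simp add: signature_def c_def j_def)
  \<comment> \<open>Only components below \<open>length s\<close> carry beads, so a nonzero entry
    excludes the empty multicharge and \<open>N\<close> really encodes a node position.\<close>
  have "c < length s" using assms unfolding signature by (auto simp: beads_of_def split: if_splits)
  then have l: "0 < length s" by linarith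
  have d: "int e dvd j - int i" and N: "position e (length s) i c j = N"
    using dvd_pos_content position_pos_component_pos_content[OF l] e by (auto simp: c_def j_def)
  consider (A) "beads_of s lam c j" "\<not> beads_of s lam c (j + 1)"
    | (R) "\<not> beads_of s lam c j" "beads_of s lam c (j + 1)"
    using assms unfolding signature by (cases "beads_of s lam c j"; cases "beads_of s lam c (j + 1)") auto
  then show ?thesis
  proof cases
    case A
    then obtain mu a where m: "mu \<in> multipartitions (length s)" "rows mu = add_box (rows lam) c a"
      and ja: "j = int (rows lam c a) - int a + s ! c" using beads_of_hop_exists[OF lam] by blast
    let ?g = "(Suc a, Suc (rows lam c a), c)"
    have "addable lam ?g" using addable_iff[OF lam] m by blast
    moreover have "content s ?g = j" using ja by simp
    ultimately have "(Letter_A, ?g) \<in> letters" "word_pos e s i (Letter_A, ?g) = N"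
      using d N by (simp_all add: i_node_dvd word_pos_def)
    then show ?thesis by blast
  next
    case R
    then obtain mu a where m: "mu \<in> multipartitions (length s)" "rows lam = add_box (rows mu) c a"
      and ja: "j = int (rows mu c a) - int a + s ! c" using beads_of_unhop_exists[OF lam] by blast
    let ?g = "(Suc a, Suc (rows mu c a), c)"
    have "removable lam ?g" using removable_iff[OF lam] m by blast
    moreover have "content s ?g = j" using ja by simp
    ultimately have "(Letter_R, ?g) \<in> letters" "word_pos e s i (Letter_R, ?g) = N"
      using d N by (simp_all add: i_node_dvd word_pos_def)
    then show ?thesis by blast
  qed
qed

lemma sorted_word_iff:
  assumes "set w = letters"
  shows "sorted_wrt (\<lambda>x y. node_less s (snd y) (snd x)) w \<longleftrightarrow> sorted_wrt (\<lambda>x y. word_pos e s i y < word_pos e s i x) w"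
proof -
  have *: "node_less s (snd y) (snd x) \<longleftrightarrow> word_pos e s i y < word_pos e s i x" if "x \<in> set w" "y \<in> set w" for x y
    unfolding node_less_def word_pos_def
    using position_less_iff[OF _ letter_beads(1) letter_beads(1) letter_beads(2) letter_beads(2)] that e
    unfolding assms by simp
  show ?thesis
  proof
    assume "sorted_wrt (\<lambda>x y. node_less s (snd y) (snd x)) w"
    then show "sorted_wrt (\<lambda>x y. word_pos e s i y < word_pos e s i x) w"
      by (rule sorted_wrt_mono_rel[rotated]) (simp add: *)
  next
    assume "sorted_wrt (\<lambda>x y. word_pos e s i y < word_pos e s i x) w"
    then show "sorted_wrt (\<lambda>x y. node_less s (snd y) (snd x)) w"
      by (rule sorted_wrt_mono_rel[rotated]) (simp add: *)
  qed
qed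

lemma i_word_exists: "\<exists>w. is_i_word e s i lam w"
proof -
  have "finite {g. removable lam g}"
    by (rule finite_subset[OF _ finite_nodes_card_nodes(1)[of lam]]) (auto simp: removable_def)
  then have "finite letters"
    using finite_addable[OF lam]
    by (intro finite_UnI)
      (auto intro: finite_subset[of _ "Pair Letter_A ` {g. addable lam g}"] finite_subset[of _ "Pair Letter_R ` {g. removable lam g}"])
  then obtain w where "set w = letters" "distinct w" "sorted_wrt (\<lambda>x y. word_pos e s i y < word_pos e s i x) w"
    using sorted_word_exists[OF _ word_pos_inj] by blast
  then show ?thesis unfolding is_i_word_def using sorted_word_iff by blast
qed

text \<open>The definition asks for some word and some sequence of cancellations. The argmax does
  not depend on them, and a word exists, so the choice is immaterial.\<close>

lemma good_node_iff:
  "good_node e s i lam g \<longleftrightarrow> addable lam g \<and> i_node e s i g \<and>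
     last_argmax (potential (signature e (length s) i (beads_of s lam))) (position e (length s) i (component g) (content s g))"
    (is "_ \<longleftrightarrow> ?R")
proof -
  have *: "(\<exists>us vs. cancel_RA\<^sup>*\<^sup>* w (us @ [(Letter_A, g)] @ vs)
        \<and> (\<forall>x\<in>set us. fst x = Letter_A) \<and> (\<forall>x\<in>set vs. fst x = Letter_R)) \<longleftrightarrow> ?R" if w: "is_i_word e s i lam w" for w
  proof -
    have S: "set w = letters" and "sorted_wrt (\<lambda>x y. node_less s (snd y) (snd x)) w"
      using w by (auto simp: is_i_word_def)
    then have srt: "sorted_wrt (\<lambda>x y. word_pos e s i y < word_pos e s i x) w" using sorted_word_iff by blast
    have "(Letter_A, g) \<in> set w \<longleftrightarrow> addable lam g \<and> i_node e s i g" unfolding S by blast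
    moreover have "word_pos e s i (Letter_A, g) = position e (length s) i (component g) (content s g)"
      by (simp add: word_pos_def)
    ultimately show ?thesis
      using cancel_RA_last_argmax[OF srt, of "signature e (length s) i (beads_of s lam)" g]
        letter_beads(3) letter_exists unfolding S by simp
  qed
  show ?thesis unfolding good_node_def using * i_word_exists by blast
qed

end

section \<open>Arrows of the crystal as hops\<close>

lemma arrow_iff_f_step:
  assumes "2 \<le> e" "0 < length s"
  shows "arrow e s i lam mu \<longleftrightarrow> i < e \<and> lam \<in> multipartitions (length s) \<and> mu \<in> multipartitions (length s)
    \<and> f_step e (length s) i (beads_of s lam) (beads_of s mu)"
proof (intro iffI)
  assume a: "arrow e s i lam mu"
  then have m: "i < e" "lam \<in> multipartitions (length s)" "mu \<in> multipartitions (length s)" by (auto simp: arrow_def)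
  obtain g where "good_node e s i lam g" and mu: "nodes mu = insert g (nodes lam)"
    using a by (auto simp: arrow_def)
  then have g: "addable lam g" "i_node e s i g"
    "last_argmax (potential (signature e (length s) i (beads_of s lam))) (position e (length s) i (component g) (content s g))"
    using good_node_iff[OF assms(1) m(2)] by auto
  then show "i < e \<and> lam \<in> multipartitions (length s) \<and> mu \<in> multipartitions (length s)
    \<and> f_step e (length s) i (beads_of s lam) (beads_of s mu)"
    using m f_stepI[OF assms addable_beads(1)[OF m(2) g(1)] _ g(3)] addable_beads(5)[OF m(2) g(1) m(3) mu]
    by (simp add: i_node_dvd)
next
  assume a: "i < e \<and> lam \<in> multipartitions (length s) \<and> mu \<in> multipartitions (length s)
    \<and> f_step e (length s) i (beads_of s lam) (beads_of s mu)"
  then have lam: "lam \<in> multipartitions (length s)" and mu: "mu \<in> multipartitions (length s)" by auto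
  obtain c j where h: "c < length s" "int e dvd j - int i" "beads_of s lam c j" "\<not> beads_of s lam c (j + 1)"
    "last_argmax (potential (signature e (length s) i (beads_of s lam))) (position e (length s) i c j)"
    "beads_of s mu = hop (beads_of s lam) c j"
    using f_stepE[OF assms] a by metis
  obtain mu' a' where mu': "mu' \<in> multipartitions (length s)" "rows mu' = add_box (rows lam) c a'"
    "j = int (rows lam c a') - int a' + s ! c" using beads_of_hop_exists[OF lam h(3,4)] by blast
  have "mu' = mu" using beads_of_add_box(4)[OF lam mu'] h(6) beads_of_inj[OF mu'(1) mu] by simp
  let ?g = "(Suc a', Suc (rows lam c a'), c)"
  have "addable lam ?g" using addable_iff[OF lam] mu' by blast
  moreover have "content s ?g = j" using mu'(3) by simp
  ultimately have "good_node e s i lam ?g" using good_node_iff[OF assms(1) lam] h by (simp add: i_node_dvd)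
  moreover have "nodes mu = insert ?g (nodes lam)"
    using nodes_insert_iff[OF lam mu'(1), of ?g] mu'(2) \<open>mu' = mu\<close> by blast
  ultimately show "arrow e s i lam mu" using a by (auto simp: arrow_def)
qed

text \<open>Configurations of multipartitions are closed under hops, forwards here and backwards in
  \<open>f_step_source\<close>. This leads from simulations of configurations back to
  vertices.\<close>

lemma f_step_target:
  assumes "2 \<le> e" "0 < length s" "lam \<in> multipartitions (length s)" "f_step e (length s) i (beads_of s lam) B"
  shows "\<exists>mu\<in>multipartitions (length s). B = beads_of s mu"
proof -
  obtain c j where h: "beads_of s lam c j" "\<not> beads_of s lam c (j + 1)" "B = hop (beads_of s lam) c j"
    using f_stepE[OF assms(1,2,4)] by metis
  show ?thesis using beads_of_hop_exists[OF assms(3) h(1,2)] beads_of_add_box(4)[OF assms(3)] h(3) by metis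
qed

lemma f_step_source:
  assumes "2 \<le> e" "0 < length s" "mu \<in> multipartitions (length s)" "f_step e (length s) i B (beads_of s mu)"
  shows "\<exists>lam\<in>multipartitions (length s). B = beads_of s lam"
proof -
  obtain c j where h: "B c j" "\<not> B c (j + 1)" "beads_of s mu = hop B c j"
    using f_stepE[OF assms(1,2,4)] by metis
  then have b: "\<not> beads_of s mu c j" "beads_of s mu c (j + 1)" by (simp_all add: hop_def)
  obtain lam a where lam: "lam \<in> multipartitions (length s)" "rows mu = add_box (rows lam) c a"
    "j = int (rows lam c a) - int a + s ! c" using beads_of_unhop_exists[OF assms(3) b] by blast
  have "B = beads_of s lam"
    using hop_inj[of B c j "beads_of s lam"] h beads_of_add_box[OF lam(1) assms(3) lam(2,3)] by auto
  then show ?thesis using lam(1) by blast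
qed

subsection \<open>Isomorphisms of crystals\<close>

text \<open>The component is reached along undirected paths from the empty vertex, so the relation
  is carried to every vertex on both sides. Being functional and injective, it restricts to a
  bijection that respects arrows.\<close>

lemma crystal_iso_of_bisimulation:
  fixes R :: "mpart \<Rightarrow> mpart \<Rightarrow> bool"
  assumes base: "R (empty_mpart (length s)) (empty_mpart (length s'))"
    and fun_R: "\<And>x y y'. R x y \<Longrightarrow> R x y' \<Longrightarrow> y = y'"
    and inj_R: "\<And>x x' y. R x y \<Longrightarrow> R x' y \<Longrightarrow> x = x'"
    and fwd: "\<And>i x y x'. R x y \<Longrightarrow> arrow e s i x x' \<Longrightarrow> \<exists>y'. arrow e s' i y y' \<and> R x' y'"
      "\<And>i x y x'. R x y \<Longrightarrow> arrow e s i x' x \<Longrightarrow> \<exists>y'. arrow e s' i y' y \<and> R x' y'"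
    and bwd: "\<And>i x y y'. R x y \<Longrightarrow> arrow e s' i y y' \<Longrightarrow> \<exists>x'. arrow e s i x x' \<and> R x' y'"
      "\<And>i x y y'. R x y \<Longrightarrow> arrow e s' i y' y \<Longrightarrow> \<exists>x'. arrow e s i x' x \<and> R x' y'"
  shows "\<exists>f. crystal_iso e s s' f"
proof -
  have ex: "\<exists>y\<in>crystal e s'. R x y" if "x \<in> crystal e s" for x
  proof -
    have "(adjacent e s)\<^sup>*\<^sup>* (empty_mpart (length s)) x" using that by (simp add: crystal_def)
    then show ?thesis
    proof (induction rule: rtranclp_induct)
      case base
      then show ?case using \<open>R _ _\<close> by (auto simp: crystal_def)
    next
      case (step y z)
      then obtain y' where y': "y' \<in> crystal e s'" "R y y'" by blast
      then obtain z' where "adjacent e s' y' z'" "R z z'"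
        using step(2) fwd unfolding adjacent_def by meson
      then show ?case using y'(1) unfolding crystal_def by (auto intro: rtranclp.rtrancl_into_rtrancl)
    qed
  qed
  have ex': "\<exists>x\<in>crystal e s. R x y" if "y \<in> crystal e s'" for y
  proof -
    have "(adjacent e s')\<^sup>*\<^sup>* (empty_mpart (length s')) y" using that by (simp add: crystal_def)
    then show ?thesis
    proof (induction rule: rtranclp_induct)
      case base
      then show ?case using \<open>R _ _\<close> by (auto simp: crystal_def)
    next
      case (step y z)
      then obtain y' where y': "y' \<in> crystal e s" "R y' y" by blast
      then obtain z' where "adjacent e s y' z'" "R z' z"
        using step(2) bwd unfolding adjacent_def by meson
      then show ?case using y'(1) unfolding crystal_def by (auto intro: rtranclp.rtrancl_into_rtrancl)
    qed
  qed
  obtain f where f: "\<And>x. x \<in> crystal e s \<Longrightarrow> f x \<in> crystal e s' \<and> R x (f x)" using ex by metis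
  have "inj_on f (crystal e s)" using f inj_R by (metis inj_onI)
  moreover have "f ` crystal e s = crystal e s'"
  proof
    show "f ` crystal e s \<subseteq> crystal e s'" using f by blast
    show "crystal e s' \<subseteq> f ` crystal e s"
    proof
      fix y assume "y \<in> crystal e s'"
      then obtain x where x: "x \<in> crystal e s" "R x y" using ex' by blast
      then have "y = f x" using f fun_R by blast
      then show "y \<in> f ` crystal e s" using x(1) by blast
    qed
  qed
  moreover have "arrow e s i x y \<longleftrightarrow> arrow e s' i (f x) (f y)" if "x \<in> crystal e s" "y \<in> crystal e s" for x y i
    using fwd(1) bwd(1) f that fun_R inj_R by metis
  ultimately have "crystal_iso e s s' f" unfolding crystal_iso_def bij_betw_def by blast
  then show ?thesis by blast
qed

lemma crystal_iso_refl: "crystal_iso e s s id"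
  by (simp add: crystal_iso_def)

lemma crystal_iso_sym:
  assumes "crystal_iso e s s' f"
  shows "crystal_iso e s' s (inv_into (crystal e s) f)"
proof -
  have b: "bij_betw f (crystal e s) (crystal e s')" using assms by (simp add: crystal_iso_def)
  have "inv_into (crystal e s) f x \<in> crystal e s" "f (inv_into (crystal e s) f x) = x" if "x \<in> crystal e s'" for x
    using b that bij_betw_inv_into_right inv_into_into unfolding bij_betw_def by (metis, metis f_inv_into_f)
  then show ?thesis using assms bij_betw_inv_into[OF b] unfolding crystal_iso_def by simp
qed

lemma crystal_iso_trans:
  assumes f: "crystal_iso e s s' f" and g: "crystal_iso e s' s'' g"
  shows "crystal_iso e s s'' (g \<circ> f)"
proof -
  have "f x \<in> crystal e s'" if "x \<in> crystal e s" for x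
    using f that unfolding crystal_iso_def bij_betw_def by blast
  then show ?thesis using f g bij_betw_trans unfolding crystal_iso_def by (metis comp_apply)
qed

section \<open>Vertices of the connected component\<close>

lemma empty_in_crystal: "empty_mpart (length s) \<in> crystal e s"
  by (simp add: crystal_def)

lemma empty_in_multipartitions: "empty_mpart l \<in> multipartitions l"
  by (simp add: empty_mpart_def multipartitions_def partition_def)

lemma rank_empty: "rank (empty_mpart l) = 0"
  by (simp add: rank_def empty_mpart_def sum_list_replicate)

lemma crystal_subset_multipartitions: "x \<in> crystal e s \<Longrightarrow> x \<in> multipartitions (length s)"
proof -
  assume "x \<in> crystal e s"
  then have "(adjacent e s)\<^sup>*\<^sup>* (empty_mpart (length s)) x" by (simp add: crystal_def)
  then show ?thesis
    by (induction rule: rtranclp_induct)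
      (auto simp: adjacent_def arrow_def empty_in_multipartitions)
qed

lemma rank_0_iff:
  assumes "x \<in> multipartitions l"
  shows "rank x = 0 \<longleftrightarrow> x = empty_mpart l"
proof
  assume r: "rank x = 0"
  have "xs = []" if "xs \<in> set x" for xs
  proof (rule ccontr)
    assume "xs \<noteq> []"
    moreover have "partition xs" using that assms by (simp add: multipartitions_def)
    moreover have "sum_list xs = 0" using r that by (auto simp: rank_def)
    ultimately show False by (cases xs) (auto simp: partition_def)
  qed
  then show "x = empty_mpart l" using assms
    by (auto simp: multipartitions_def empty_mpart_def intro: replicate_eqI)
qed (simp add: rank_empty)

lemma crystal_induct [consumes 1, case_names base step]:
  assumes "x \<in> crystal e s" "P (empty_mpart (length s))"
    "\<And>y z. y \<in> crystal e s \<Longrightarrow> z \<in> crystal e s \<Longrightarrow> adjacent e s y z \<Longrightarrow> P y \<Longrightarrow> P z"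
  shows "P x"
proof -
  have "(adjacent e s)\<^sup>*\<^sup>* (empty_mpart (length s)) x" using assms(1) by (simp add: crystal_def)
  then show ?thesis
  proof (induction rule: rtranclp_induct)
    case (step y z)
    then have "y \<in> crystal e s" "z \<in> crystal e s" unfolding crystal_def by auto
    then show ?case using step assms(3) by blast
  qed (rule assms(2))
qed

lemma beads_of_empty: "beads_of s (empty_mpart (length s)) c j \<longleftrightarrow> c < length s \<and> j \<le> s ! c"
proof -
  have "rows (empty_mpart (length s)) c a = 0" for a
    using rows_pos_iff[OF empty_in_multipartitions, of "length s" c a] by (auto simp: empty_mpart_def)
  moreover have "(\<exists>a. j = s ! c - int a) \<longleftrightarrow> j \<le> s ! c"
  proof
    assume "j \<le> s ! c"
    then have "j = s ! c - int (nat (s ! c - j))" by simp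
    then show "\<exists>a. j = s ! c - int a" by blast
  qed auto
  ultimately show ?thesis by (auto simp: beads_of_def)
qed

section \<open>Moves between the empty multipartitions of swapped charges\<close>

lemma relpowp_move_step_det: "(move_step c ^^ k) B B1 \<Longrightarrow> (move_step c ^^ k) B B2 \<Longrightarrow> B1 = B2"
  by (induction k arbitrary: B1 B2) (auto dest: move_step_det)

lemma relpowp_move_step_codet: "(move_step c ^^ k) B1 B \<Longrightarrow> (move_step c ^^ k) B2 B \<Longrightarrow> B1 = B2"
  by (induction k arbitrary: B) (auto dest: move_step_codet)

text \<open>The shape reached after the beads \<open>a\<close> down to \<open>k + 1\<close> have
  passed to \<open>Suc c\<close>: the next bead to move is the topmost one left in
  \<open>c\<close>.\<close>

lemma move_step_staircase:
  fixes a b k :: int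
  assumes "b < k" "k \<le> a" "\<And>j. B c j \<longleftrightarrow> j \<le> k" "\<And>j. B (Suc c) j \<longleftrightarrow> j \<le> b \<or> k < j \<and> j \<le> a"
  shows "move_step c B (move_bead c B k)"
proof -
  \<comment> \<open>The tail sums of \<open>row_signature\<close>, which is \<open>1\<close> on the
    contents from \<open>k + 1\<close> to \<open>a\<close>, \<open>-1\<close> on those from
    \<open>b + 1\<close> to \<open>k\<close>, and \<open>0\<close> elsewhere. They first peak at
    \<open>k + 1\<close>.\<close>
  define D where "D m = max 0 (min (a - m + 1) (a - k)) - max 0 (min (k - m + 1) (k - b))" for m
  have "is_potential (row_signature c B) D"
    unfolding is_potential_def row_signature_def assms(3,4) D_def using assms(1,2) by (auto simp: max_def min_def)
  moreover have "first_argmax D (k + 1)"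
    unfolding first_argmax_def D_def using assms(1,2) by (auto simp: max_def min_def)
  ultimately show ?thesis unfolding move_step_def using first_argmax_is_potential is_potential_potential by blast
qed

text \<open>For the empty multipartition the two abaci are filled up to \<open>a\<close> and up to
  \<open>b\<close>. Passing the beads \<open>a\<close> down to \<open>b + 1\<close> one by one
  exchanges them; \<open>St k\<close> is the state after \<open>k\<close> moves.\<close>

lemma relpowp_move_step_empty:
  fixes a b :: int
  assumes "b \<le> a" and s: "s = xs @ a # b # ys" and s': "s' = xs @ b # a # ys"
  shows "(move_step (length xs) ^^ nat (a - b)) (beads_of s (empty_mpart (length s))) (beads_of s' (empty_mpart (length s')))"
proof -
  let ?c = "length xs"
  define St where "St k c j = (if c = ?c then j \<le> a - int k else if c = Suc ?c then j \<le> b \<or> a - int k < j \<and> j \<le> a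
     else beads_of s (empty_mpart (length s)) c j)" for k c j
  have "(move_step ?c ^^ k) (St 0) (St k)" if "k \<le> nat (a - b)" for k
    using that
  proof (induction k)
    case (Suc k)
    have "move_step ?c (St k) (move_bead ?c (St k) (a - int k))"
      by (rule move_step_staircase[of b _ a]) (use Suc.prems in \<open>auto simp: St_def\<close>)
    moreover have "move_bead ?c (St k) (a - int k) = St (Suc k)"
      using Suc.prems by (auto simp: move_bead_def St_def fun_eq_iff)
    ultimately show ?case using Suc by auto
  qed simp
  moreover have "St 0 = beads_of s (empty_mpart (length s))"
    by (intro ext, unfold St_def beads_of_empty) (auto simp: s nth_append)
  moreover have "St (nat (a - b)) = beads_of s' (empty_mpart (length s'))"
    using assms(1)
    by (intro ext, unfold St_def beads_of_empty) (auto simp: s s' nth_append nth_Cons split: nat.splits)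
  ultimately show ?thesis by (metis order_refl)
qed

section \<open>Ranks and uniqueness of isomorphisms\<close>

context
  fixes e :: nat
  assumes e: "2 \<le> e"
begin

lemma arrow_rank:
  assumes "arrow e s i x y"
  shows "rank y = Suc (rank x)"
proof -
  obtain g where g: "good_node e s i x g" "nodes y = insert g (nodes x)" and x: "x \<in> multipartitions (length s)"
    using assms by (auto simp: arrow_def)
  then have "g \<notin> nodes x" using good_node_iff[OF e x] by (auto simp: addable_def)
  then show ?thesis using g(2) finite_nodes_card_nodes by (metis card_insert_disjoint)
qed

lemma arrow_deterministic:
  assumes "0 < length s" "arrow e s i x y" "arrow e s i x y'"
  shows "y = y'"
  using assms(2,3) f_step_det beads_of_inj unfolding arrow_iff_f_step[OF e assms(1)] by blast

lemma arrow_codeterministic: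
  assumes "0 < length s" "arrow e s i x y" "arrow e s i x' y"
  shows "x = x'"
  using assms(2,3) f_step_codet[OF e assms(1)] beads_of_inj unfolding arrow_iff_f_step[OF e assms(1)] by blast

text \<open>Adjacent vertices differ in rank by one, so an isomorphism shifts ranks by a constant; the
  empty multipartitions, the only vertices of rank \<open>0\<close>, force this constant to vanish.\<close>

lemma crystal_iso_rank:
  assumes f: "crystal_iso e s s' f" and x: "x \<in> crystal e s"
  shows "rank (f x) = rank x"
proof -
  let ?d = "rank (f (empty_mpart (length s)))"
  have shift: "rank (f x) = rank x + ?d" if "x \<in> crystal e s" for x
    using that
  proof (induction rule: crystal_induct)
    case base
    then show ?case by (simp add: rank_empty)
  next
    case (step y z)
    then obtain i where "arrow e s i y z \<or> arrow e s i z y" "i < e"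
    using arrow_def[of e s] by (metis adjacent_def)
    then have "arrow e s i y z \<and> arrow e s' i (f y) (f z) \<or> arrow e s i z y \<and> arrow e s' i (f z) (f y)"
      using f step(1,2) unfolding crystal_iso_def by blast
    then show ?case using step(4) arrow_rank by fastforce
  qed
  obtain x0 where "x0 \<in> crystal e s" "f x0 = empty_mpart (length s')"
    using f empty_in_crystal[of s'] unfolding crystal_iso_def bij_betw_def by (metis image_iff)
  then have "?d = 0" using shift[of x0] rank_empty[of "length s'"] by simp
  then show ?thesis using shift[OF x] by simp
qed

lemma crystal_iso_empty:
  assumes f: "crystal_iso e s s' f"
  shows "f (empty_mpart (length s)) = empty_mpart (length s')"
proof -
  have "f (empty_mpart (length s)) \<in> crystal e s'"
    using f empty_in_crystal[of s] unfolding crystal_iso_def bij_betw_def by blast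
  then show ?thesis
    using crystal_iso_rank[OF f empty_in_crystal] rank_0_iff[OF crystal_subset_multipartitions] rank_empty by metis
qed

lemma crystal_iso_unique:
  assumes "0 < length s'" and f: "crystal_iso e s s' f" and g: "crystal_iso e s s' g" and x: "x \<in> crystal e s"
  shows "f x = g x"
  using x
proof (induction rule: crystal_induct)
  case base
  then show ?case using crystal_iso_empty[OF f] crystal_iso_empty[OF g] by simp
next
  case (step y z)
  then obtain i where i: "arrow e s i y z \<or> arrow e s i z y" "i < e"
    using arrow_def[of e s] by (metis adjacent_def)
  then have "arrow e s' i (f y) (f z) \<and> arrow e s' i (g y) (g z) \<or> arrow e s' i (f z) (f y) \<and> arrow e s' i (g z) (g y)"
    using f g step(1,2) unfolding crystal_iso_def by blast
  then show ?case using step(4) arrow_deterministic[OF assms(1)] arrow_codeterministic[OF assms(1)] by metis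
qed

text \<open>Any isomorphism, made extensional by restriction, witnesses the definite description. So
  the existence of an isomorphism is all that must be shown for \<open>Gamma\<close>.\<close>

lemma crystal_iso_Gamma:
  assumes "0 < length s'" and f: "crystal_iso e s s' f"
  shows "crystal_iso e s s' (Gamma e s s')"
proof -
  have "bij_betw (restrict f (crystal e s)) (crystal e s) (crystal e s')"
    using f bij_betw_cong[of "crystal e s" "restrict f (crystal e s)" f "crystal e s'"] unfolding crystal_iso_def by simp
  then have r: "crystal_iso e s s' (restrict f (crystal e s))"
    using f unfolding crystal_iso_def by simp
  have "\<exists>!h. h \<in> extensional (crystal e s) \<and> crystal_iso e s s' h"
  proof
    show "restrict f (crystal e s) \<in> extensional (crystal e s) \<and> crystal_iso e s s' (restrict f (crystal e s))"
      using r by simp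
    fix h assume "h \<in> extensional (crystal e s) \<and> crystal_iso e s s' h"
    then show "h = restrict f (crystal e s)"
      using crystal_iso_unique[OF assms(1) _ r] by (intro extensionalityI[of _ "crystal e s"]) auto
  qed
  from theI'[OF this] show ?thesis unfolding Gamma_def by blast
qed

lemma Gamma_image_crystal_rank:
  assumes "0 < length s'" and "crystal_iso e s s' f"
  shows "crystal_rank e s' n = Gamma e s s' ` crystal_rank e s n"
proof -
  note G = crystal_iso_Gamma[OF assms]
  have "Gamma e s s' ` crystal e s = crystal e s'" using G unfolding crystal_iso_def bij_betw_def by blast
  then show ?thesis using crystal_iso_rank[OF G] unfolding crystal_rank_def by force
qed

section \<open>Bisimulations and the exchange of neighbouring charges\<close>

definition f_bisimulation :: "nat \<Rightarrow> (beads \<Rightarrow> beads \<Rightarrow> bool) \<Rightarrow> bool" where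
  "f_bisimulation l R \<longleftrightarrow> (\<forall>i B B1. R B B1 \<longrightarrow>
      (\<forall>B2. f_step e l i B B2 \<longrightarrow> (\<exists>B3. f_step e l i B1 B3 \<and> R B2 B3))
    \<and> (\<forall>B3. f_step e l i B1 B3 \<longrightarrow> (\<exists>B2. f_step e l i B B2 \<and> R B2 B3))
    \<and> (\<forall>B2. f_step e l i B2 B \<longrightarrow> (\<exists>B3. f_step e l i B3 B1 \<and> R B2 B3))
    \<and> (\<forall>B3. f_step e l i B3 B1 \<longrightarrow> (\<exists>B2. f_step e l i B2 B \<and> R B2 B3)))"

lemma f_bisimulationD:
  assumes "f_bisimulation l R" "R B B1"
  shows "f_step e l i B B2 \<Longrightarrow> \<exists>B3. f_step e l i B1 B3 \<and> R B2 B3"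
    and "f_step e l i B1 B3 \<Longrightarrow> \<exists>B2. f_step e l i B B2 \<and> R B2 B3"
    and "f_step e l i B2 B \<Longrightarrow> \<exists>B3. f_step e l i B3 B1 \<and> R B2 B3"
    and "f_step e l i B3 B1 \<Longrightarrow> \<exists>B2. f_step e l i B2 B \<and> R B2 B3"
  using assms unfolding f_bisimulation_def by blast+

lemma f_bisimulation_eq: "f_bisimulation l (=)"
  by (simp add: f_bisimulation_def)

lemma f_bisimulation_relcompp:
  assumes R: "f_bisimulation l R" and S: "f_bisimulation l S"
  shows "f_bisimulation l (R OO S)"
proof -
  have 1: "\<exists>B3. f_step e l i B1 B3 \<and> (R OO S) B2 B3" if "(R OO S) B B1" "f_step e l i B B2" for i B B1 B2
    using that f_bisimulationD(1)[OF R] f_bisimulationD(1)[OF S] unfolding relcompp_apply by meson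
  have 2: "\<exists>B2. f_step e l i B B2 \<and> (R OO S) B2 B3" if "(R OO S) B B1" "f_step e l i B1 B3" for i B B1 B3
    using that f_bisimulationD(2)[OF R] f_bisimulationD(2)[OF S] unfolding relcompp_apply by meson
  have 3: "\<exists>B3. f_step e l i B3 B1 \<and> (R OO S) B2 B3" if "(R OO S) B B1" "f_step e l i B2 B" for i B B1 B2
    using that f_bisimulationD(3)[OF R] f_bisimulationD(3)[OF S] unfolding relcompp_apply by meson
  have 4: "\<exists>B2. f_step e l i B2 B \<and> (R OO S) B2 B3" if "(R OO S) B B1" "f_step e l i B3 B1" for i B B1 B3
    using that f_bisimulationD(4)[OF R] f_bisimulationD(4)[OF S] unfolding relcompp_apply by meson
  show ?thesis unfolding f_bisimulation_def
    by (intro allI impI conjI; elim 1 2 3 4)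
qed

text \<open>Only single moves were analysed; bisimulations compose, so iterated moves inherit all
  four simulation properties.\<close>

lemma f_bisimulation_relpowp_move_step:
  assumes "Suc c < l"
  shows "f_bisimulation l (move_step c ^^ k)"
proof (induction k)
  case 0
  then show ?case using f_bisimulation_eq by simp
next
  case (Suc k)
  have "f_bisimulation l (move_step c)"
    unfolding f_bisimulation_def using move_step_f_step_simulation[OF e _ assms] assms by blast
  then show ?case using Suc f_bisimulation_relcompp by simp
qed

text \<open>Vertices are related when \<open>a - b\<close> moves carry the beads of one to those of
  the other. Intermediate configurations are treated as bare beads; at the ends
  \<open>f_step_target\<close> and \<open>f_step_source\<close> supply the multipartitions.\<close>

lemma crystal_iso_swap_ge:
  fixes a b :: int
  assumes "b \<le> a" and s: "s = xs @ a # b # ys" and s': "s' = xs @ b # a # ys"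
  shows "\<exists>f. crystal_iso e s s' f"
proof (rule crystal_iso_of_bisimulation)
  let ?c = "length xs" and ?k = "nat (a - b)"
  let ?R = "\<lambda>x y. x \<in> multipartitions (length s) \<and> y \<in> multipartitions (length s') \<and>
    (move_step ?c ^^ ?k) (beads_of s x) (beads_of s' y)"
  have len: "length s' = length s" and pos: "0 < length s" "0 < length s'" and c: "Suc ?c < length s"
    by (auto simp: s s')
  note arr = arrow_iff_f_step[OF e pos(1)] arrow_iff_f_step[OF e pos(2)]
  note sim = f_bisimulationD[OF f_bisimulation_relpowp_move_step[OF c, of ?k]]
  show "?R (empty_mpart (length s)) (empty_mpart (length s'))"
    using relpowp_move_step_empty[OF assms] empty_in_multipartitions by blast
  show "y = y'" if "?R x y" "?R x y'" for x y y'
    using that relpowp_move_step_det beads_of_inj by blast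
  show "x = x'" if "?R x y" "?R x' y" for x x' y
    using that relpowp_move_step_codet beads_of_inj by blast
  note tgt = f_step_target[OF e pos(1)] f_step_target[OF e pos(2), unfolded len]
  note src = f_step_source[OF e pos(1)] f_step_source[OF e pos(2), unfolded len]
  fix i x y x' y' assume R: "?R x y"
  show "\<exists>y'. arrow e s' i y y' \<and> ?R x' y'" if "arrow e s i x x'"
    using R sim(1)[of "beads_of s x" "beads_of s' y" i "beads_of s x'"] that tgt(2)[of y i]
    unfolding arr len by metis
  show "\<exists>y'. arrow e s' i y' y \<and> ?R x' y'" if "arrow e s i x' x"
    using R sim(3)[of "beads_of s x" "beads_of s' y" i "beads_of s x'"] that src(2)[of y i]
    unfolding arr len by metis
  show "\<exists>x'. arrow e s i x x' \<and> ?R x' y'" if "arrow e s' i y y'"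
    using R sim(2)[of "beads_of s x" "beads_of s' y" i "beads_of s' y'"] that tgt(1)[of x i]
    unfolding arr len by metis
  show "\<exists>x'. arrow e s i x' x \<and> ?R x' y'" if "arrow e s' i y' y"
    using R sim(4)[of "beads_of s x" "beads_of s' y" i "beads_of s' y'"] that src(1)[of x i]
    unfolding arr len by metis
qed

end

subsection \<open>Multicharges in one orbit\<close>

text \<open>Component \<open>0\<close> at content \<open>j + e\<close> comes directly after
  component \<open>l - 1\<close> at content \<open>j\<close>. Making component \<open>0\<close> the
  last one while lowering its contents by \<open>e\<close> therefore lowers every position by one
  and keeps the order.\<close>

definition cyclic_shift :: "nat \<Rightarrow> nat \<Rightarrow> beads \<Rightarrow> beads" where
  "cyclic_shift e l B c j = (if Suc c < l then B (Suc c) j else Suc c = l \<and> B 0 (j + int e))"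

lemma pos_component_pos_content_mult_add:
  assumes "c < l"
  shows "pos_component l (q * int l + int c) = c" "pos_content e l i (q * int l + int c) = int i + int e * q"
  using assms by (simp_all add: pos_component_def pos_content_def)

text \<open>Increasing positions run through the components of one content and then continue with
  component \<open>0\<close> at the content larger by \<open>e\<close>; only there does the content
  change.\<close>

lemma cyclic_shift_position:
  assumes l: "0 < l"
  obtains "Suc (pos_component l (N - 1)) < l" "pos_component l N = Suc (pos_component l (N - 1))" "pos_content e l i N = pos_content e l i (N - 1)"
  | "Suc (pos_component l (N - 1)) = l" "pos_component l N = 0" "pos_content e l i N = pos_content e l i (N - 1) + int e"
proof -
  define q c where "q = (N - 1) div int l" and "c = pos_component l (N - 1)"
  have c: "c < l" using pos_component_less[OF l] by (simp add: c_def)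
  have N: "N - 1 = q * int l + int c" using l by (simp add: q_def c_def pos_component_def)
  have i: "pos_content e l i (N - 1) = int i + int e * q" by (simp add: pos_content_def q_def)
  show ?thesis
  proof (cases "Suc c < l")
    case True
    have "N = q * int l + int (Suc c)" using N by simp
    then have "pos_component l N = Suc c" "pos_content e l i N = int i + int e * q"
      using pos_component_pos_content_mult_add[OF True] by metis+
    then show ?thesis using that(1) True i by (simp add: c_def)
  next
    case False
    then have "Suc c = l" using c by simp
    then have "N = (q + 1) * int l + int 0" using N by (simp add: algebra_simps flip: \<open>Suc c = l\<close>)
    then have "pos_component l N = 0" "pos_content e l i N = int i + int e * (q + 1)"
      using pos_component_pos_content_mult_add[OF l] by metis+
    then show ?thesis using that(2) \<open>Suc c = l\<close> i by (simp add: c_def algebra_simps)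
  qed
qed

lemma signature_cyclic_shift:
  assumes "0 < l"
  shows "signature e l i (cyclic_shift e l B) (N - 1) = signature e l i B N"
  by (rule cyclic_shift_position[OF assms, of N e i]) (auto simp: signature_def cyclic_shift_def add.commute add.left_commute)

lemma cyclic_shift_hop:
  assumes "0 < l"
  shows "cyclic_shift e l (hop B (pos_component l N) (pos_content e l i N)) = hop (cyclic_shift e l B) (pos_component l (N - 1)) (pos_content e l i (N - 1))"
  by (rule cyclic_shift_position[OF assms, of N e i]) (auto simp: hop_def cyclic_shift_def fun_eq_iff)

text \<open>The signature is translated by one place, so a translate of the old potential serves as
  the new one.\<close>

lemma last_argmax_cyclic_shift:
  assumes "0 < l"
  shows "last_argmax (potential (signature e l i (cyclic_shift e l B))) (N - 1) \<longleftrightarrow> last_argmax (potential (signature e l i B)) N"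
proof -
  let ?D = "potential (signature e l i B)"
  have "?D (M + 1) = ?D (M + 1 + 1) + signature e l i (cyclic_shift e l B) M" for M
    using potential_step[of "signature e l i B" "M + 1"] signature_cyclic_shift[OF assms, of e i B "M + 1"] by simp
  then have p: "is_potential (signature e l i (cyclic_shift e l B)) (\<lambda>M. ?D (M + 1))" unfolding is_potential_def by blast
  have "last_argmax (\<lambda>M. ?D (M + 1)) (N - 1) \<longleftrightarrow> last_argmax ?D N"
    unfolding last_argmax_def
    by (metis add_less_cancel_right diff_add_cancel)
  then show ?thesis using last_argmax_is_potential[OF is_potential_potential p] by blast
qed

lemma f_step_cyclic_shift:
  assumes "0 < l" "f_step e l i B B'"
  shows "f_step e l i (cyclic_shift e l B) (cyclic_shift e l B')"
  using assms(2) cyclic_shift_hop[OF assms(1)] last_argmax_cyclic_shift[OF assms(1)] unfolding f_step_def by metis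

lemma f_step_cyclic_shiftD:
  assumes "0 < l" "f_step e l i (cyclic_shift e l B) B1"
  shows "\<exists>B'. B1 = cyclic_shift e l B' \<and> f_step e l i B B'"
proof -
  obtain N where N: "last_argmax (potential (signature e l i (cyclic_shift e l B))) N" "B1 = hop (cyclic_shift e l B) (pos_component l N) (pos_content e l i N)"
    using assms(2) unfolding f_step_def by blast
  then have "last_argmax (potential (signature e l i B)) (N + 1)"
    using last_argmax_cyclic_shift[OF assms(1), of e i B "N + 1"] by simp
  then have "f_step e l i B (hop B (pos_component l (N + 1)) (pos_content e l i (N + 1)))"
    unfolding f_step_def by blast
  then show ?thesis using N(2) cyclic_shift_hop[OF assms(1), of e B "N + 1" i] by (metis add_diff_cancel_right')
qed

lemma beads_of_cyclic_shift:
  assumes "length x = length s" "s \<noteq> []"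
  shows "beads_of (tl s @ [hd s - int e]) (tl x @ [hd x]) = cyclic_shift e (length s) (beads_of s x)"
proof (intro ext)
  fix c j
  obtain a t where s: "s = a # t" using assms(2) by (cases s) auto
  obtain y u where x: "x = y # u" and len: "length u = length t" using assms(1) s by (cases x) auto
  consider "c < length t" | "c = length t" | "c > length t" by linarith
  then show "beads_of (tl s @ [hd s - int e]) (tl x @ [hd x]) c j = cyclic_shift e (length s) (beads_of s x) c j"
  proof cases
    case 1
    then show ?thesis by (simp add: s x len beads_of_def cyclic_shift_def rows_def nth_append)
  next
    case 2
    have "j = int r - int b + (a - int e) \<longleftrightarrow> j + int e = int r - int b + a" for r b by auto
    then show ?thesis using 2 by (simp add: s x len beads_of_def cyclic_shift_def rows_def nth_append)
  next
    case 3
    then show ?thesis by (simp add: s x beads_of_def cyclic_shift_def)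
  qed
qed

context
  fixes e :: nat
  assumes e: "2 \<le> e"
begin

text \<open>The isomorphism is explicit: it rotates the list of components. On all multipartitions
  this is a bijection that matches arrows, because the beads undergo
  \<open>cyclic_shift\<close>.\<close>

lemma crystal_iso_cyclic_shift:
  assumes "s \<noteq> []"
  shows "\<exists>f. crystal_iso e s (tl s @ [hd s - int e]) f"
proof (rule crystal_iso_of_bisimulation)
  let ?s' = "tl s @ [hd s - int e]" and ?t = "\<lambda>x. tl x @ [hd x]"
  let ?R = "\<lambda>x y. x \<in> multipartitions (length s) \<and> y = ?t x"
  have len: "length ?s' = length s" and pos: "0 < length s" "0 < length ?s'" using assms by auto
  note arr = arrow_iff_f_step[OF e pos(1)] arrow_iff_f_step[OF e pos(2)]
  have ne: "x \<noteq> []" if "x \<in> multipartitions (length s)" for x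
    using that assms by (auto simp: multipartitions_def)
  have tm: "?t x \<in> multipartitions (length s)" if "x \<in> multipartitions (length s)" for x
    using that ne[OF that] assms by (cases x) (auto simp: multipartitions_def)
  have surj: "\<exists>x\<in>multipartitions (length s). y = ?t x" if "y \<in> multipartitions (length s)" for y
  proof (rule bexI[of _ "last y # butlast y"])
    show "y = ?t (last y # butlast y)" using ne[OF that] by simp
    show "last y # butlast y \<in> multipartitions (length s)"
      using that ne[OF that] pos(1) by (auto simp: multipartitions_def dest: in_set_butlastD)
  qed
  have beads: "beads_of ?s' (?t x) = cyclic_shift e (length s) (beads_of s x)" if "x \<in> multipartitions (length s)" for x
    using beads_of_cyclic_shift[of x s e] that assms by (simp add: multipartitions_def)
  have arrow: "arrow e s i x x' \<longleftrightarrow> arrow e ?s' i (?t x) (?t x')"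
    if x: "x \<in> multipartitions (length s)" "x' \<in> multipartitions (length s)" for i x x'
  proof
    assume "arrow e s i x x'"
    then show "arrow e ?s' i (?t x) (?t x')"
      using x tm f_step_cyclic_shift[OF pos(1)] unfolding arr len beads[OF x(1)] beads[OF x(2)] by blast
  next
    assume a: "arrow e ?s' i (?t x) (?t x')"
    then obtain B where B: "cyclic_shift e (length s) (beads_of s x') = cyclic_shift e (length s) B" "f_step e (length s) i (beads_of s x) B"
      using f_step_cyclic_shiftD[OF pos(1)] unfolding arr len beads[OF x(1)] beads[OF x(2)] by blast
    \<comment> \<open>\<open>cyclic_shift\<close> forgets components from \<open>l\<close> on, so
      \<open>B\<close> is first recognised as coming from a multipartition, and equality is
      concluded there.\<close>
    obtain z where z: "z \<in> multipartitions (length s)" "B = beads_of s z"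
      using f_step_target[OF e pos(1) x(1) B(2)] by blast
    have "?t x' = ?t z"
      using beads_of_inj[of "?t x'" ?s' "?t z"] tm[OF x(2)] tm[OF z(1)] B(1) z(2) beads[OF x(2)] beads[OF z(1)]
      unfolding len by simp
    then have "x' = z" using ne[OF x(2)] ne[OF z(1)] by (metis append1_eq_conv list.collapse)
    then show "arrow e s i x x'" using a B(2) z x unfolding arr by blast
  qed
  have empty: "?t (empty_mpart (length s)) = empty_mpart (length ?s')"
    using assms by (cases s) (simp_all add: empty_mpart_def replicate_append_same)
  show "?R (empty_mpart (length s)) (empty_mpart (length ?s'))"
    using empty empty_in_multipartitions by simp
  show "x = x'" if "?R x y" "?R x' y" for x x' y
    using that ne by (metis append1_eq_conv list.collapse)
  show "y = y'" if "?R x y" "?R x y'" for x y y' using that by blast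
  have mp: "arrow e s i x y \<Longrightarrow> x \<in> multipartitions (length s) \<and> y \<in> multipartitions (length s)"
    "arrow e ?s' i x y \<Longrightarrow> x \<in> multipartitions (length s) \<and> y \<in> multipartitions (length s)" for i x y
    unfolding arr len by blast+
  fix i x y x' y' assume R: "?R x y"
  show "\<exists>y'. arrow e ?s' i y y' \<and> ?R x' y'" if "arrow e s i x x'" using arrow that mp R by blast
  show "\<exists>y'. arrow e ?s' i y' y \<and> ?R x' y'" if "arrow e s i x' x" using arrow that mp R by blast
  show "\<exists>x'. arrow e s i x x' \<and> ?R x' y'" if "arrow e ?s' i y y'"
    using arrow that mp(2)[OF that] R surj by blast
  show "\<exists>x'. arrow e s i x' x \<and> ?R x' y'" if "arrow e ?s' i y' y"
    using arrow that mp(2)[OF that] R surj by blast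
qed

section \<open>Isomorphic crystals along an orbit\<close>

definition crystals_isomorphic :: "int list \<Rightarrow> int list \<Rightarrow> bool" where
  "crystals_isomorphic s s' \<longleftrightarrow> (\<exists>f. crystal_iso e s s' f)"

lemma crystals_isomorphic_refl: "crystals_isomorphic s s"
  using crystal_iso_refl unfolding crystals_isomorphic_def by blast

lemma crystals_isomorphic_sym: "crystals_isomorphic s s' \<Longrightarrow> crystals_isomorphic s' s"
  using crystal_iso_sym unfolding crystals_isomorphic_def by blast

lemma crystals_isomorphic_trans [trans]:
  "crystals_isomorphic s s' \<Longrightarrow> crystals_isomorphic s' s'' \<Longrightarrow> crystals_isomorphic s s''"
  using crystal_iso_trans unfolding crystals_isomorphic_def by blast

lemma crystals_isomorphic_swap: "crystals_isomorphic (xs @ a # b # ys) (xs @ b # a # ys)"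
proof (cases "b \<le> a")
  case True
  then show ?thesis using crystal_iso_swap_ge[OF e] unfolding crystals_isomorphic_def by blast
next
  case False
  then have "crystals_isomorphic (xs @ b # a # ys) (xs @ a # b # ys)"
    using crystal_iso_swap_ge[OF e, of a b] unfolding crystals_isomorphic_def by simp
  then show ?thesis by (rule crystals_isomorphic_sym)
qed

text \<open>The entry \<open>x\<close> passes the entries of \<open>ys\<close> one at a time by
  swaps of neighbours.\<close>

lemma crystals_isomorphic_rotate: "crystals_isomorphic (p @ x # ys @ q) (p @ ys @ x # q)"
proof (induction ys arbitrary: p)
  case (Cons y ys)
  have "crystals_isomorphic (p @ x # y # ys @ q) (p @ y # x # ys @ q)"
    by (rule crystals_isomorphic_swap)
  also have "crystals_isomorphic (p @ y # x # ys @ q) (p @ y # ys @ x # q)"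
    using Cons[of "p @ [y]"] by simp
  finally show ?case by simp
qed (simp add: crystals_isomorphic_refl)

text \<open>Sorting by insertion: the first entry is carried to its place in \<open>s'\<close> and
  the tail is handled recursively. The prefix \<open>p\<close> collects entries already in
  place.\<close>

lemma crystals_isomorphic_mset:
  "mset s = mset s' \<Longrightarrow> crystals_isomorphic (p @ s) (p @ s')"
proof (induction s arbitrary: p s')
  case Nil
  then show ?case by (simp add: crystals_isomorphic_refl)
next
  case (Cons x t)
  then have "x \<in> set s'" by (metis list.set_intros(1) set_mset_mset)
  then obtain u v where s': "s' = u @ x # v" by (metis split_list)
  then have "mset t = mset (u @ v)" using Cons.prems by simp
  then have "crystals_isomorphic (p @ x # t) (p @ x # u @ v)"
    using Cons.IH[of "u @ v" "p @ [x]"] by simp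
  also have "crystals_isomorphic (p @ x # u @ v) (p @ u @ x # v)" by (rule crystals_isomorphic_rotate)
  finally show ?case using s' by simp
qed

text \<open>The entry is permuted to the end, brought to the front and raised by \<open>e\<close>
  through an inverse cyclic shift, and permuted back to its place.\<close>

lemma crystals_isomorphic_shift:
  assumes "c < length s"
  shows "crystals_isomorphic s (s[c := s ! c + int e])"
proof -
  define a p q where "a = s ! c" and "p = take c s" and "q = drop (Suc c) s"
  have s: "s = p @ a # q" using assms by (simp add: a_def p_def q_def id_take_nth_drop)
  have s': "s[c := s ! c + int e] = p @ (a + int e) # q"
    using assms by (simp add: upd_conv_take_nth_drop a_def p_def q_def)
  have m: "crystals_isomorphic t t'" if "mset t = mset t'" for t t'
    using crystals_isomorphic_mset[OF that, of "[]"] by simp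
  have "crystals_isomorphic s ((p @ q) @ [a])" by (rule m) (simp add: s)
  \<comment> \<open>The cyclic shift takes \<open>(a + int e) # p @ q\<close> to
    \<open>(p @ q) @ [a]\<close>; symmetry reverses it.\<close>
  also have "crystals_isomorphic ((p @ q) @ [a]) ((a + int e) # p @ q)"
    using crystal_iso_cyclic_shift[of "(a + int e) # p @ q"] crystals_isomorphic_sym
    unfolding crystals_isomorphic_def[symmetric] by simp
  also have "crystals_isomorphic ((a + int e) # p @ q) (p @ (a + int e) # q)" by (rule m) simp
  finally show ?thesis unfolding s' .
qed

lemma crystals_isomorphic_coord_perm:
  assumes "p permutes {..<l}" "s \<in> multicharges l"
  shows "crystals_isomorphic s (coord_perm l p s)"
proof -
  have "length s = l" using assms(2) by (simp add: multicharges_def)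
  then have "coord_perm l p s = permute_list p s"
    using assms(2) by (simp add: coord_perm_def permute_list_def)
  then have "mset (coord_perm l p s) = mset s"
    using assms(1) \<open>length s = l\<close> by (simp add: mset_permute_list)
  then show ?thesis using crystals_isomorphic_mset[of s _ "[]"] by simp
qed

text \<open>Induction over the generated group: permutations and translations were treated above,
  products follow by transitivity, and for an inverse symmetry is applied at the preimage.\<close>

lemma crystals_isomorphic_ext_affine_sym:
  assumes w: "w \<in> carrier (ext_affine_sym e l)" and s: "s \<in> multicharges l"
  shows "w s \<in> multicharges l \<and> crystals_isomorphic s (w s)"
proof -
  let ?S = "multicharges l" and ?G = "BijGroup (multicharges l)"
  let ?gens = "{coord_perm l p | p. p permutes {..<l}} \<union> {coord_shift e l c | c. c < l}"
  have gens: "h t \<in> ?S \<and> crystals_isomorphic t (h t)" if "h \<in> ?gens" "h \<in> carrier ?G" "t \<in> ?S" for h t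
  proof
    show "h t \<in> ?S" using that(2,3) by (auto simp: BijGroup_def dest: Bij_imp_funcset)
    from that(1) show "crystals_isomorphic t (h t)"
      using crystals_isomorphic_coord_perm crystals_isomorphic_shift that(3)
      by (auto simp: coord_shift_def multicharges_def)
  qed
  have sub: "generate ?G (carrier ?G \<inter> ?gens) \<subseteq> carrier ?G"
    using group.generate_incl[OF group_BijGroup] by blast
  have "w \<in> generate ?G (carrier ?G \<inter> ?gens)"
    using w by (simp add: ext_affine_sym_def carrier_subgroup_generated)
  then have "\<forall>s\<in>?S. w s \<in> ?S \<and> crystals_isomorphic s (w s)"
  proof (induction rule: generate.induct)
    case one
    then show ?case by (simp add: BijGroup_def crystals_isomorphic_refl)
  next
    case (incl h)
    then show ?case using gens by blast
  next
    case (inv h)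
    show ?case
    proof
      fix t assume t: "t \<in> ?S"
      have h: "h \<in> Bij ?S" using inv by (simp add: BijGroup_def)
      then have "bij_betw h ?S ?S" by (simp add: Bij_def)
      then have "inv_into ?S h t \<in> ?S" "h (inv_into ?S h t) = t"
        using t unfolding bij_betw_def by (auto intro: inv_into_into f_inv_into_f)
      moreover have "(inv\<^bsub>?G\<^esub> h) t = inv_into ?S h t" using inv_BijGroup[OF h] t by simp
      ultimately show "(inv\<^bsub>?G\<^esub> h) t \<in> ?S \<and> crystals_isomorphic t ((inv\<^bsub>?G\<^esub> h) t)"
        using gens[of h "inv_into ?S h t"] inv crystals_isomorphic_sym by auto
    qed
  next
    case (eng h1 h2)
    then have "h1 \<in> Bij ?S" "h2 \<in> Bij ?S" using sub by (auto simp: BijGroup_def)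
    then have "(h1 \<otimes>\<^bsub>?G\<^esub> h2) t = h1 (h2 t)" if "t \<in> ?S" for t
      using that by (simp add: BijGroup_def compose_def)
    moreover have "h1 (h2 t) \<in> ?S \<and> crystals_isomorphic t (h1 (h2 t))" if "t \<in> ?S" for t
      using eng.IH that crystals_isomorphic_trans by blast
    ultimately show ?case by simp
  qed
  then show ?thesis using s by blast
qed

end

text \<open>The inverse is taken in the generated subgroup, whose product is inherited from
  \<open>BijGroup\<close> and hence is composition of maps on the multicharges.\<close>

lemma ext_affine_sym_inv_apply:
  assumes w: "w \<in> carrier (ext_affine_sym e l)" and s: "s \<in> multicharges l"
  shows "(inv\<^bsub>ext_affine_sym e l\<^esub> w) (w s) = s"
proof -
  let ?E = "ext_affine_sym e l" and ?G = "BijGroup (multicharges l)"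
  have E: "group ?E" unfolding ext_affine_sym_def by (rule group.group_subgroup_generated[OF group_BijGroup])
  have sub: "carrier ?E \<subseteq> Bij (multicharges l)"
    using group.carrier_subgroup_generated_subset[OF group_BijGroup] unfolding ext_affine_sym_def
    by (simp add: BijGroup_def)
  have iw: "inv\<^bsub>?E\<^esub> w \<in> carrier ?E" using group.inv_closed[OF E w] .
  have "(inv\<^bsub>?E\<^esub> w) \<otimes>\<^bsub>?E\<^esub> w = \<one>\<^bsub>?E\<^esub>" by (rule group.l_inv[OF E w])
  then have "(inv\<^bsub>?E\<^esub> w) \<otimes>\<^bsub>?G\<^esub> w = \<one>\<^bsub>?G\<^esub>" by (simp add: ext_affine_sym_def)
  then have "compose (multicharges l) (inv\<^bsub>?E\<^esub> w) w = (\<lambda>x\<in>multicharges l. x)"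
    using subsetD[OF sub iw] subsetD[OF sub w] by (simp add: BijGroup_def)
  from fun_cong[OF this, of s] show ?thesis using s by (simp add: compose_def)
qed

theorem proposition5p3p1:
  fixes e l n :: nat and s st :: "int list" and w :: "int list \<Rightarrow> int list"
  assumes "e \<ge> 2" and "l \<ge> 1"
    and "s \<in> multicharges l"
    and "st \<in> orbit (ext_affine_sym e l) (\<lambda>g. g) s" and "in_fundamental_domain e st"
    and "w \<in> carrier (ext_affine_sym e l)" and "w s = st"
  shows "crystal_rank e s n
           = {Gamma e st ((inv\<^bsub>ext_affine_sym e l\<^esub> w) st) mu | mu. mu \<in> crystal_rank e st n}"
proof -
  \<comment> \<open>This identifies the target of \<open>Gamma\<close> with the crystal of
    \<open>s\<close>, so it remains to map the crystal of \<open>st\<close> onto it.\<close>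
  have inv: "(inv\<^bsub>ext_affine_sym e l\<^esub> w) st = s"
    using ext_affine_sym_inv_apply[OF assms(6,3)] assms(7) by simp
  have "crystals_isomorphic e st s"
    using crystals_isomorphic_ext_affine_sym[OF assms(1,6,3)] assms(7) crystals_isomorphic_sym[OF assms(1)] by blast
  then obtain f where "crystal_iso e st s f" unfolding crystals_isomorphic_def[OF assms(1)] by blast
  moreover have "0 < length s" using assms(2,3) by (simp add: multicharges_def)
  ultimately have "crystal_rank e s n = Gamma e st s ` crystal_rank e st n"
    using Gamma_image_crystal_rank[OF assms(1)] by blast
  then show ?thesis unfolding inv by blast
qed

end
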